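(* Let $X$ be a metric space. The following are equivalent. (i) $X$ is quasihyperbolic and weakly roughly geodesic. (ii) $X$ is hyperbolic in the sense of the four-point condition and weakly roughly geodesic. (iii) $X$ is $\operatorname{Isom}X$-equivariantly roughly isometric to the geodesic space $E(X)$, its injective hull, and $E(X)$ is hyperbolic.
   Context: Let $(X,d)$ be a metric space. A $(q,q)$-quasigeodesic is a $(q,q)$-quasiisometric embedding of an interval. $X$ is $(q_0,q_0)$-quasigeodesic if every two points are joined by a $(q_0,q_0)$-quasigeodesic. $X$ is quasihyperbolic if there is a constant $q_0$ such that $X$ is $(q_0,q_0)$-quasigeodesic and for every $q$ there is a constant $\delta$ such that every triangle in $X$ whose sides are $(q,q)$-quasigeodesics is $\delta$-thin (each side lies in the $\delta$-neighbourhood of the union of the other two). $X$ is weakly roughly geodesic if there is a constant $C$ such that for all $x,y\in X$ and all $r\in[0,d(x,y)]$ there is $z\in X$ with $d(x,z)\le r+C$ and $d(z,y)\le(d(x,y)-r)+C$. The four-point condition: there is $\delta$ such that $(x|z)_w\ge\min\{(x|y)_w,(y|z)_w\}-\delta$ for all $w,x,y,z$, where $(x|y)_w=\frac12(d(x,w)+d(y,w)-d(x,y))$. A geodesic space is injective if every family of pairwise intersecting balls has nonempty total intersection. The injective hull $E(X)$ is the essentially unique injective space with an isometric embedding $e:X\to E(X)$ such that any other isometric embedding of $X$ in an injective space factors via $e$; isometries of $X$ extend naturally to $E(X)$. A rough isometry is a quasiisometry with multiplicative constant $1$, i.e. a $(1,k)$-quasiisometry for some $k$. *)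

theory Defs
  imports "HOL-Analysis.Analysis"
begin

section \<open>Coarse geometry of metric spaces\<close>

definition isometric_embedding :: "'a metric \<Rightarrow> 'b metric \<Rightarrow> ('a \<Rightarrow> 'b) \<Rightarrow> bool" where
  "isometric_embedding X Y f \<longleftrightarrow> f \<in> mspace X \<rightarrow> mspace Y \<and>
     (\<forall>x\<in>mspace X. \<forall>y\<in>mspace X. mdist Y (f x) (f y) = mdist X x y)"

definition quasi_isometric_embedding ::
    "'a metric \<Rightarrow> 'b metric \<Rightarrow> real \<Rightarrow> real \<Rightarrow> ('a \<Rightarrow> 'b) \<Rightarrow> bool" where
  "quasi_isometric_embedding X Y L k f \<longleftrightarrow> 1 \<le> L \<and> 0 \<le> k \<and> f \<in> mspace X \<rightarrow> mspace Y \<and>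
     (\<forall>x\<in>mspace X. \<forall>y\<in>mspace X.
        mdist X x y / L - k \<le> mdist Y (f x) (f y) \<and> mdist Y (f x) (f y) \<le> L * mdist X x y + k)"

definition quasi_isometry ::
    "'a metric \<Rightarrow> 'b metric \<Rightarrow> real \<Rightarrow> real \<Rightarrow> ('a \<Rightarrow> 'b) \<Rightarrow> bool" where
  "quasi_isometry X Y L k f \<longleftrightarrow> quasi_isometric_embedding X Y L k f \<and>
     (\<forall>y\<in>mspace Y. \<exists>x\<in>mspace X. mdist Y (f x) y \<le> k)"

definition rough_isometry :: "'a metric \<Rightarrow> 'b metric \<Rightarrow> ('a \<Rightarrow> 'b) \<Rightarrow> bool" where
  "rough_isometry X Y f \<longleftrightarrow> (\<exists>k. quasi_isometry X Y 1 k f)"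

text \<open>\<open>S\<close> is the image of a $(q,q)$-quasigeodesic from \<open>x\<close> to \<open>y\<close>. Quasigeodesics are not
  required to be continuous. Since quasi-isometric embeddings have multiplicative constant at
  least 1, this entails \<open>1 \<le> q\<close>.\<close>

definition quasigeodesic_side :: "'a metric \<Rightarrow> real \<Rightarrow> 'a \<Rightarrow> 'a \<Rightarrow> 'a set \<Rightarrow> bool" where
  "quasigeodesic_side X q x y S \<longleftrightarrow>
     (\<exists>(a::real) b c. a \<le> b \<and> quasi_isometric_embedding (submetric euclidean_metric {a..b}) X q q c \<and>
        c a = x \<and> c b = y \<and> S = c ` {a..b})"

definition quasigeodesic_space :: "'a metric \<Rightarrow> real \<Rightarrow> bool" where
  "quasigeodesic_space X q \<longleftrightarrow> (\<forall>x\<in>mspace X. \<forall>y\<in>mspace X. \<exists>S. quasigeodesic_side X q x y S)"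

definition nbhd :: "'a metric \<Rightarrow> real \<Rightarrow> 'a set \<Rightarrow> 'a set" where
  "nbhd X \<delta> S = (\<Union>p\<in>S. mcball_of X p \<delta>)"

definition thin_triangle :: "'a metric \<Rightarrow> real \<Rightarrow> 'a set \<Rightarrow> 'a set \<Rightarrow> 'a set \<Rightarrow> bool" where
  "thin_triangle X \<delta> S T U \<longleftrightarrow>
     S \<subseteq> nbhd X \<delta> (T \<union> U) \<and> T \<subseteq> nbhd X \<delta> (U \<union> S) \<and> U \<subseteq> nbhd X \<delta> (S \<union> T)"

definition quasihyperbolic :: "'a metric \<Rightarrow> bool" where
  "quasihyperbolic X \<longleftrightarrow>
     (\<exists>q\<^sub>0. 1 \<le> q\<^sub>0 \<and> quasigeodesic_space X q\<^sub>0) \<and>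
     (\<forall>q\<ge>1. \<exists>\<delta>. \<forall>x\<in>mspace X. \<forall>y\<in>mspace X. \<forall>z\<in>mspace X. \<forall>S T U.
        quasigeodesic_side X q x y S \<longrightarrow> quasigeodesic_side X q y z T \<longrightarrow>
        quasigeodesic_side X q z x U \<longrightarrow> thin_triangle X \<delta> S T U)"

definition weakly_roughly_geodesic :: "'a metric \<Rightarrow> bool" where
  "weakly_roughly_geodesic X \<longleftrightarrow>
     (\<exists>C. \<forall>x\<in>mspace X. \<forall>y\<in>mspace X. \<forall>r\<in>{0..mdist X x y}. \<exists>z\<in>mspace X.
        mdist X x z \<le> r + C \<and> mdist X z y \<le> (mdist X x y - r) + C)"

definition Gromov_product :: "'a metric \<Rightarrow> 'a \<Rightarrow> 'a \<Rightarrow> 'a \<Rightarrow> real" where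
  "Gromov_product X w x y = 1/2 * (mdist X x w + mdist X y w - mdist X x y)"

definition four_point_hyperbolic :: "'a metric \<Rightarrow> bool" where
  "four_point_hyperbolic X \<longleftrightarrow>
     (\<exists>\<delta>. \<forall>w\<in>mspace X. \<forall>x\<in>mspace X. \<forall>y\<in>mspace X. \<forall>z\<in>mspace X.
        Gromov_product X w x z \<ge> min (Gromov_product X w x y) (Gromov_product X w y z) - \<delta>)"

section \<open>Injective spaces and injective hulls\<close>

definition geodesic_space :: "'a metric \<Rightarrow> bool" where
  "geodesic_space X \<longleftrightarrow> (\<forall>x\<in>mspace X. \<forall>y\<in>mspace X. \<exists>c.
     isometric_embedding (submetric euclidean_metric {0..mdist X x y}) X c \<and>
     c 0 = x \<and> c (mdist X x y) = y)"

text \<open>Families of closed balls are given by their sets of pairs (centre, radius). Only nonempty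
  families are considered, so the empty metric space is injective.\<close>

definition injective_space :: "'a metric \<Rightarrow> bool" where
  "injective_space X \<longleftrightarrow> geodesic_space X \<and>
     (\<forall>\<B> \<subseteq> mspace X \<times> UNIV. \<B> \<noteq> {} \<and>
        (\<forall>(x,r)\<in>\<B>. \<forall>(y,s)\<in>\<B>. mcball_of X x r \<inter> mcball_of X y s \<noteq> {})
        \<longrightarrow> (\<Inter>(x,r)\<in>\<B>. mcball_of X x r) \<noteq> {})"

text \<open>The factor \<open>h\<close> is required to be an isometric embedding; a merely 1-Lipschitz factor exists
  for every isometric embedding \<open>e\<close> into a metric space. The universal property cannot quantify
  over all types, so the test spaces \<open>Z\<close> live on the type \<open>'a \<Rightarrow> real\<close>, on which the injective hull
  can be realised as the space of extremal functions. This is no loss: the theorems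
  \<open>injective_hull_factor\<close> and \<open>injective_hull_exists\<close> below show that a hull in this sense has the
  universal property with respect to injective spaces on every type, and that it exists.\<close>

definition injective_hull :: "'a metric \<Rightarrow> 'e metric \<Rightarrow> ('a \<Rightarrow> 'e) \<Rightarrow> bool" where
  "injective_hull X E e \<longleftrightarrow> injective_space E \<and> isometric_embedding X E e \<and>
     (\<forall>(Z::('a \<Rightarrow> real) metric) i. injective_space Z \<and> isometric_embedding X Z i \<longrightarrow>
        (\<exists>h. isometric_embedding E Z h \<and> (\<forall>x\<in>mspace X. h (e x) = i x)))"

text \<open>Isometries are represented by extensional functions, so that equality of isometries is
  equality of functions.\<close>

definition Isom :: "'a metric \<Rightarrow> ('a \<Rightarrow> 'a) set" where
  "Isom X = {\<phi> \<in> extensional (mspace X).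
     isometric_embedding X X \<phi> \<and> bij_betw \<phi> (mspace X) (mspace X)}"

text \<open>The extension of an isometry of \<open>X\<close> to the hull; see \<open>hull_isometry_ex1\<close> below for existence
  and uniqueness.\<close>

definition hull_isometry :: "'a metric \<Rightarrow> 'e metric \<Rightarrow> ('a \<Rightarrow> 'e) \<Rightarrow> ('a \<Rightarrow> 'a) \<Rightarrow> 'e \<Rightarrow> 'e" where
  "hull_isometry X E e \<phi> = (THE \<Phi>. \<Phi> \<in> Isom E \<and> (\<forall>x\<in>mspace X. \<Phi> (e x) = e (\<phi> x)))"

definition equivariantly_roughly_isometric_to_hull ::
    "'a metric \<Rightarrow> 'e metric \<Rightarrow> ('a \<Rightarrow> 'e) \<Rightarrow> bool" where
  "equivariantly_roughly_isometric_to_hull X E e \<longleftrightarrow>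
     (\<exists>f. rough_isometry X E f \<and>
        (\<forall>\<phi>\<in>Isom X. \<forall>x\<in>mspace X. f (\<phi> x) = hull_isometry X E e \<phi> (f x)))"

section \<open>Existence of injective hulls\<close>

definition hyperconvex :: "'a metric \<Rightarrow> bool" where
  "hyperconvex X \<longleftrightarrow>
     (\<forall>\<B> \<subseteq> mspace X \<times> UNIV. \<B> \<noteq> {} \<and> (\<forall>(x,r)\<in>\<B>. \<forall>(y,s)\<in>\<B>. mdist X x y \<le> r + s)
        \<longrightarrow> (\<exists>z\<in>mspace X. \<forall>(x,r)\<in>\<B>. mdist X x z \<le> r))"

lemma mdist_refl [simp]: "x \<in> mspace X \<Longrightarrow> mdist X x x = 0"
  by simp

lemma hyperconvexD:
  assumes "hyperconvex X" "\<B> \<subseteq> mspace X \<times> UNIV" "\<B> \<noteq> {}"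
    and "\<And>x r y s. \<lbrakk>(x,r) \<in> \<B>; (y,s) \<in> \<B>\<rbrakk> \<Longrightarrow> mdist X x y \<le> r + s"
  obtains z where "z \<in> mspace X" "\<And>x r. (x,r) \<in> \<B> \<Longrightarrow> mdist X x z \<le> r"
proof -
  have "\<forall>(x,r)\<in>\<B>. \<forall>(y,s)\<in>\<B>. mdist X x y \<le> r + s" using assms(4) by auto
  then have "\<exists>z\<in>mspace X. \<forall>(x,r)\<in>\<B>. mdist X x z \<le> r"
    using assms(1)[unfolded hyperconvex_def, rule_format, of \<B>] assms(2,3) by simp
  then obtain z where "z \<in> mspace X" "\<forall>(x,r)\<in>\<B>. mdist X x z \<le> r" ..
  then show thesis by (intro that[of z]) auto
qed

lemma injective_imp_hyperconvex:
  assumes "injective_space X"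
  shows "hyperconvex X"
  unfolding hyperconvex_def
proof (intro allI impI, elim conjE)
  fix \<B> assume sub: "\<B> \<subseteq> mspace X \<times> UNIV" and ne: "\<B> \<noteq> {}"
    and le: "\<forall>(x,r)\<in>\<B>. \<forall>(y,s)\<in>\<B>. mdist X x y \<le> r + s"
  have "mcball_of X x r \<inter> mcball_of X y s \<noteq> {}" if B: "(x,r)\<in>\<B>" "(y,s)\<in>\<B>" for x r y s
  proof -
    have xy: "x \<in> mspace X" "y \<in> mspace X" using sub B by auto
    let ?D = "mdist X x y"
    obtain c where c: "isometric_embedding (submetric euclidean_metric {0..?D}) X c"
        "c 0 = x" "c ?D = y"
      using assms xy unfolding injective_space_def geodesic_space_def by blast
    have "?D \<le> r + s" "mdist X x x \<le> r + r" "mdist X y y \<le> s + s" using le B by blast+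
    then have "?D \<le> r + s" "0 \<le> r" "0 \<le> s" using xy by auto
    define t where "t = min r ?D"
    have t: "0 \<le> t" "t \<le> ?D" "t \<le> r" "?D - t \<le> s"
      using \<open>?D \<le> r + s\<close> \<open>0 \<le> r\<close> \<open>0 \<le> s\<close> by (auto simp: t_def)
    have cd: "mdist X (c u) (c v) = \<bar>u - v\<bar>" if "u \<in> {0..?D}" "v \<in> {0..?D}" for u v
      using c(1) that by (auto simp: isometric_embedding_def dist_real_def)
    have "c t \<in> mspace X"
      using c(1) t unfolding isometric_embedding_def by (auto simp: Pi_iff)
    moreover have "mdist X x (c t) = t" using cd[of 0 t] t c by auto
    moreover have "mdist X y (c t) = ?D - t" using cd[of ?D t] t c by auto
    ultimately show ?thesis using t xy by (auto simp: set_eq_iff)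
  qed
  then have "\<forall>(x,r)\<in>\<B>. \<forall>(y,s)\<in>\<B>. mcball_of X x r \<inter> mcball_of X y s \<noteq> {}"
    by blast
  then have "(\<Inter>(x,r)\<in>\<B>. mcball_of X x r) \<noteq> {}"
    using conjunct2[OF assms[unfolded injective_space_def], rule_format, of \<B>] sub ne by simp
  then obtain z where z: "z \<in> (\<Inter>(x,r)\<in>\<B>. mcball_of X x r)" by (meson ex_in_conv)
  have zB: "z \<in> mcball_of X x r" if "(x,r) \<in> \<B>" for x r
    using INT_D[OF z that] by simp
  obtain x r where "(x,r) \<in> \<B>" using ne by auto
  then have "z \<in> mspace X" using zB[of x r] by simp
  moreover have "\<forall>(x,r)\<in>\<B>. mdist X x z \<le> r" using zB by auto
  ultimately show "\<exists>z\<in>mspace X. \<forall>(x,r)\<in>\<B>. mdist X x z \<le> r" by (rule bexI[rotated])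
qed

text \<open>Extension of 1-Lipschitz maps into hyperconvex spaces, by Zorn's lemma applied to graphs.\<close>

lemma lipschitz_extension:
  assumes Z: "hyperconvex Z" and A: "A \<subseteq> mspace Y" "A \<noteq> {}" "g \<in> A \<rightarrow> mspace Z"
    and lip: "\<And>x y. \<lbrakk>x \<in> A; y \<in> A\<rbrakk> \<Longrightarrow> mdist Z (g x) (g y) \<le> mdist Y x y"
  obtains h where "h \<in> mspace Y \<rightarrow> mspace Z"
    "\<And>x y. \<lbrakk>x \<in> mspace Y; y \<in> mspace Y\<rbrakk> \<Longrightarrow> mdist Z (h x) (h y) \<le> mdist Y x y"
    "\<And>x. x \<in> A \<Longrightarrow> h x = g x"
proof -
  define G where "G = (\<lambda>x. (x, g x)) ` A"
  define \<A> where "\<A> = {H. G \<subseteq> H \<and> H \<subseteq> mspace Y \<times> mspace Z \<and>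
    (\<forall>(x,u)\<in>H. \<forall>(y,v)\<in>H. mdist Z u v \<le> mdist Y x y)}"
  have "G \<in> \<A>" using A lip by (auto simp: \<A>_def G_def Pi_iff)
  have "\<exists>H\<in>\<A>. \<forall>K\<in>\<A>. H \<subseteq> K \<longrightarrow> K = H"
  proof (rule subset_Zorn_nonempty)
    show "\<A> \<noteq> {}" using \<open>G \<in> \<A>\<close> by auto
    fix \<C> assume ne: "\<C> \<noteq> {}" and ch: "subset.chain \<A> \<C>"
    have sub: "\<C> \<subseteq> \<A>" and tot: "\<And>H K. H \<in> \<C> \<Longrightarrow> K \<in> \<C> \<Longrightarrow> H \<subseteq> K \<or> K \<subseteq> H"
      using ch by (auto simp: subset_chain_def)
    have "G \<subseteq> \<Union>\<C>" using ne sub unfolding \<A>_def by blast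
    moreover have "\<Union>\<C> \<subseteq> mspace Y \<times> mspace Z" using sub unfolding \<A>_def by blast
    moreover have "mdist Z u v \<le> mdist Y x y" if xu: "(x,u) \<in> \<Union>\<C>" and yv: "(y,v) \<in> \<Union>\<C>" for x u y v
    proof -
      obtain H K where HK: "H \<in> \<C>" "(x,u) \<in> H" "K \<in> \<C>" "(y,v) \<in> K" using xu yv by auto
      then obtain L where "L \<in> \<C>" "(x,u) \<in> L" "(y,v) \<in> L" using tot by blast
      then show ?thesis using sub unfolding \<A>_def by fastforce
    qed
    ultimately show "\<Union>\<C> \<in> \<A>" unfolding \<A>_def by blast
  qed
  then obtain H where H: "H \<in> \<A>" and max: "\<And>K. K \<in> \<A> \<Longrightarrow> H \<subseteq> K \<Longrightarrow> K = H" by blast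
  have HG: "G \<subseteq> H" and HYZ: "H \<subseteq> mspace Y \<times> mspace Z"
    and Hl: "\<And>x u y v. (x,u)\<in>H \<Longrightarrow> (y,v)\<in>H \<Longrightarrow> mdist Z u v \<le> mdist Y x y"
    using H by (auto simp: \<A>_def)
  have "H \<noteq> {}" using HG A by (auto simp: G_def)
  have total: "\<exists>u. (y,u) \<in> H" if y: "y \<in> mspace Y" for y
  proof -
    define \<B> where "\<B> = {(u, mdist Y x y) | x u. (x,u) \<in> H}"
    obtain z where z0: "z \<in> mspace Z" "\<And>u r. (u,r) \<in> \<B> \<Longrightarrow> mdist Z u z \<le> r"
    proof (rule hyperconvexD[OF Z])
      show "\<B> \<subseteq> mspace Z \<times> UNIV" using HYZ by (auto simp: \<B>_def)
      show "\<B> \<noteq> {}" using \<open>H \<noteq> {}\<close> by (auto simp: \<B>_def)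
      show "mdist Z u v \<le> r + s" if uv: "(u,r) \<in> \<B>" "(v,s) \<in> \<B>" for u r v s
      proof -
        obtain x x' where x: "(x,u) \<in> H" "r = mdist Y x y" "(x',v) \<in> H" "s = mdist Y x' y"
          using uv unfolding \<B>_def by blast
        then have "x \<in> mspace Y" "x' \<in> mspace Y" using HYZ by auto
        then have "mdist Y x x' \<le> r + s"
          using mdist_triangle[of x Y y x'] y x by (simp add: mdist_commute)
        then show ?thesis using Hl[OF x(1,3)] by simp
      qed
    qed blast
    have z: "z \<in> mspace Z" "\<And>x u. (x,u) \<in> H \<Longrightarrow> mdist Z u z \<le> mdist Y x y"
      using z0 unfolding \<B>_def by blast+
    have "insert (y,z) H \<in> \<A>"
      using HG HYZ Hl z y by (auto simp: \<A>_def mdist_commute)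
    then show ?thesis using max by blast
  qed
  define h where "h y = (SOME u. (y,u) \<in> H)" for y
  have h: "(y, h y) \<in> H" if "y \<in> mspace Y" for y
    unfolding h_def using total[OF that] by (rule someI_ex)
  show ?thesis
  proof
    show "h \<in> mspace Y \<rightarrow> mspace Z" using h HYZ by auto
    show "mdist Z (h x) (h y) \<le> mdist Y x y" if "x \<in> mspace Y" "y \<in> mspace Y" for x y
      using Hl h that by blast
    show "h x = g x" if "x \<in> A" for x
    proof -
      have "(x, g x) \<in> H" "(x, h x) \<in> H" using that HG h A by (auto simp: G_def)
      moreover from this have "mdist Z (h x) (g x) \<le> 0" using Hl[of x "h x" x "g x"] that A by auto
      ultimately show ?thesis using HYZ mdist_nonneg[of Z "h x" "g x"]
        by (metis mdist_zero SigmaD2 order_antisym subsetD)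
    qed
  qed
qed

lemma hyperconvex_imp_injective:
  assumes X: "hyperconvex X"
  shows "injective_space X"
  unfolding injective_space_def
proof
  show "geodesic_space X"
    unfolding geodesic_space_def
  proof (intro ballI)
    fix x y assume xy: "x \<in> mspace X" "y \<in> mspace X"
    let ?D = "mdist X x y" let ?I = "submetric euclidean_metric {0..?D}"
    define g where "g t = (if t = 0 then x else y)" for t :: real
    have g: "g 0 = x" "g ?D = y" using xy by (auto simp: g_def)
    obtain h where h: "h \<in> mspace ?I \<rightarrow> mspace X"
        "\<And>s t. \<lbrakk>s \<in> mspace ?I; t \<in> mspace ?I\<rbrakk> \<Longrightarrow> mdist X (h s) (h t) \<le> mdist ?I s t"
        "\<And>t. t \<in> {0,?D} \<Longrightarrow> h t = g t"
    proof (rule lipschitz_extension[OF X, of "{0,?D}" ?I g])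
      show "mdist X (g s) (g t) \<le> mdist ?I s t" if "s \<in> {0,?D}" "t \<in> {0,?D}" for s t
        using that g xy by (auto simp: dist_real_def mdist_commute)
    qed (use xy in \<open>auto simp: g_def\<close>)
    have h0: "h 0 = x" "h ?D = y" using h(3) g by auto
    have hs: "h s \<in> mspace X" if "s \<in> {0..?D}" for s using h(1) that by auto
    have le: "mdist X (h s) (h t) \<le> \<bar>s - t\<bar>" if "s \<in> {0..?D}" "t \<in> {0..?D}" for s t
      using h(2)[of s t] that by (auto simp: dist_real_def)
    have eq: "mdist X (h s) (h t) = t - s" if "0 \<le> s" "s \<le> t" "t \<le> ?D" for s t
    proof -
      have "?D \<le> mdist X x (h s) + mdist X (h s) (h t) + mdist X (h t) y"
        using mdist_triangle[of x X "h s" y] mdist_triangle[of "h s" X "h t" y] xy hs[of s] hs[of t] that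
        by auto
      then show ?thesis using le[of 0 s] le[of s t] le[of t ?D] h0 that by auto
    qed
    have "mdist X (h s) (h t) = \<bar>s - t\<bar>" if "s \<in> {0..?D}" "t \<in> {0..?D}" for s t
      using eq[of s t] eq[of t s] that by (cases "s \<le> t") (auto simp: mdist_commute)
    then show "\<exists>c. isometric_embedding ?I X c \<and> c 0 = x \<and> c ?D = y"
      using h0 hs by (intro exI[of _ h]) (auto simp: isometric_embedding_def dist_real_def)
  qed
  show "\<forall>\<B> \<subseteq> mspace X \<times> UNIV. \<B> \<noteq> {} \<and>
        (\<forall>(x,r)\<in>\<B>. \<forall>(y,s)\<in>\<B>. mcball_of X x r \<inter> mcball_of X y s \<noteq> {})
        \<longrightarrow> (\<Inter>(x,r)\<in>\<B>. mcball_of X x r) \<noteq> {}"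
  proof (intro allI impI, elim conjE)
    fix \<B> assume sub: "\<B> \<subseteq> mspace X \<times> UNIV" and ne: "\<B> \<noteq> {}"
      and int: "\<forall>(x,r)\<in>\<B>. \<forall>(y,s)\<in>\<B>. mcball_of X x r \<inter> mcball_of X y s \<noteq> {}"
    have "mdist X x y \<le> r + s" if B: "(x,r)\<in>\<B>" "(y,s)\<in>\<B>" for x r y s
    proof -
      have "mcball_of X x r \<inter> mcball_of X y s \<noteq> {}" using int B by blast
      then obtain z where "x \<in> mspace X" "y \<in> mspace X" "z \<in> mspace X"
          "mdist X x z \<le> r" "mdist X y z \<le> s" by auto
      then show ?thesis using mdist_triangle[of x X z y] by (simp add: mdist_commute)
    qed
    then obtain z where z: "z \<in> mspace X" "\<And>x r. (x,r) \<in> \<B> \<Longrightarrow> mdist X x z \<le> r"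
      using hyperconvexD[OF X sub ne] by metis
    have "z \<in> mcball_of X x r" if "(x,r) \<in> \<B>" for x r
      using z that sub by auto
    then have "z \<in> (\<Inter>(x,r)\<in>\<B>. mcball_of X x r)" by auto
    then show "(\<Inter>(x,r)\<in>\<B>. mcball_of X x r) \<noteq> {}" by blast
  qed
qed

text \<open>Isbell's space of extremal functions with the supremum metric.\<close>

definition dominating :: "'a metric \<Rightarrow> ('a \<Rightarrow> real) \<Rightarrow> bool" where
  "dominating X f \<longleftrightarrow> (\<forall>x\<in>mspace X. \<forall>y\<in>mspace X. mdist X x y \<le> f x + f y)"

definition extremal_functions :: "'a metric \<Rightarrow> ('a \<Rightarrow> real) set" where
  "extremal_functions X = {f \<in> extensional (mspace X). dominating X f \<and>
     (\<forall>g. dominating X g \<and> (\<forall>x\<in>mspace X. g x \<le> f x) \<longrightarrow> (\<forall>x\<in>mspace X. g x = f x))}"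

definition extremal_dist :: "'a metric \<Rightarrow> ('a \<Rightarrow> real) \<Rightarrow> ('a \<Rightarrow> real) \<Rightarrow> real" where
  "extremal_dist X f g =
     (if f \<in> extremal_functions X \<and> g \<in> extremal_functions X then SUP x\<in>mspace X. \<bar>f x - g x\<bar> else 0)"

definition tight_span :: "'a metric \<Rightarrow> ('a \<Rightarrow> real) metric" where
  "tight_span X = metric (extremal_functions X, extremal_dist X)"

definition Kuratowski :: "'a metric \<Rightarrow> 'a \<Rightarrow> 'a \<Rightarrow> real" where
  "Kuratowski X x = restrict (mdist X x) (mspace X)"

lemma extremal_exists:
  assumes U: "U \<subseteq> mspace X \<times> UNIV" and fib: "\<And>x. x \<in> mspace X \<Longrightarrow> \<exists>s. (x,s) \<in> U"
    and dom: "\<And>x s y t. (x,s) \<in> U \<Longrightarrow> (y,t) \<in> U \<Longrightarrow> mdist X x y \<le> s + t"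
  obtains f where "f \<in> extremal_functions X" "\<And>x s. (x,s) \<in> U \<Longrightarrow> f x \<le> s"
proof -
  define \<A> where "\<A> = {V. U \<subseteq> V \<and> V \<subseteq> mspace X \<times> UNIV \<and>
     (\<forall>(x,s)\<in>V. \<forall>(y,t)\<in>V. mdist X x y \<le> s + t)}"
  have "U \<in> \<A>" using U dom by (auto simp: \<A>_def)
  have "\<exists>H\<in>\<A>. \<forall>K\<in>\<A>. H \<subseteq> K \<longrightarrow> K = H"
  proof (rule subset_Zorn_nonempty)
    show "\<A> \<noteq> {}" using \<open>U \<in> \<A>\<close> by auto
    fix \<C> assume ne: "\<C> \<noteq> {}" and ch: "subset.chain \<A> \<C>"
    have sub: "\<C> \<subseteq> \<A>" and tot: "\<And>H K. H \<in> \<C> \<Longrightarrow> K \<in> \<C> \<Longrightarrow> H \<subseteq> K \<or> K \<subseteq> H"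
      using ch by (auto simp: subset_chain_def)
    have "U \<subseteq> \<Union>\<C>" using ne sub unfolding \<A>_def by blast
    moreover have "\<Union>\<C> \<subseteq> mspace X \<times> UNIV" using sub unfolding \<A>_def by blast
    moreover have "mdist X x y \<le> s + t" if xs: "(x,s) \<in> \<Union>\<C>" and yt: "(y,t) \<in> \<Union>\<C>" for x s y t
    proof -
      obtain H K where HK: "H \<in> \<C>" "(x,s) \<in> H" "K \<in> \<C>" "(y,t) \<in> K" using xs yt by auto
      then obtain L where "L \<in> \<C>" "(x,s) \<in> L" "(y,t) \<in> L" using tot by blast
      then show ?thesis using sub unfolding \<A>_def by fastforce
    qed
    ultimately show "\<Union>\<C> \<in> \<A>" unfolding \<A>_def by blast
  qed
  then obtain V where V: "V \<in> \<A>" and max: "\<And>K. K \<in> \<A> \<Longrightarrow> V \<subseteq> K \<Longrightarrow> K = V" by blast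
  have UV: "U \<subseteq> V" and VX: "V \<subseteq> mspace X \<times> UNIV"
    and Vd: "\<And>x s y t. (x,s) \<in> V \<Longrightarrow> (y,t) \<in> V \<Longrightarrow> mdist X x y \<le> s + t"
    using V by (auto simp: \<A>_def)
  define f where "f = restrict (\<lambda>x. Inf {s. (x,s) \<in> V}) (mspace X)"
  have ne: "{s. (x,s) \<in> V} \<noteq> {}" if "x \<in> mspace X" for x using fib[OF that] UV by auto
  have V0: "0 \<le> s" if "(x,s) \<in> V" for x s using Vd[OF that that] VX that mdist_refl[of x X] by auto
  have bdd: "bdd_below {s. (x,s) \<in> V}" for x using V0 by (auto intro!: bdd_belowI[of _ 0])
  have fle: "f x \<le> s" if "(x,s) \<in> V" for x s
    using that VX bdd cInf_lower[of s "{s. (x,s) \<in> V}"] by (auto simp: f_def)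
  have fge: "c \<le> f x" if "x \<in> mspace X" "\<And>s. (x,s) \<in> V \<Longrightarrow> c \<le> s" for x c
    using that ne cInf_greatest[of "{s. (x,s) \<in> V}" c] by (auto simp: f_def)
  have domf: "dominating X f"
    unfolding dominating_def
  proof (intro ballI)
    fix x y assume xy: "x \<in> mspace X" "y \<in> mspace X"
    have "mdist X x y - f y \<le> f x"
    proof (rule fge[OF xy(1)])
      fix s assume s: "(x,s) \<in> V"
      have "mdist X x y - s \<le> f y"
        by (rule fge[OF xy(2)]) (use Vd[OF s] in \<open>force\<close>)
      then show "mdist X x y - f y \<le> s" by simp
    qed
    then show "mdist X x y \<le> f x + f y" by simp
  qed
  have "g x = f x" if g: "dominating X g" "\<forall>x\<in>mspace X. g x \<le> f x" and x: "x \<in> mspace X" for g x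
  proof -
    define K where "K = {(x,s). x \<in> mspace X \<and> g x \<le> s}"
    have "V \<subseteq> K" using fle VX g(2) by (fastforce simp: K_def)
    moreover have "K \<in> \<A>"
    proof -
      have "mdist X x y \<le> s + t" if "(x,s) \<in> K" "(y,t) \<in> K" for x s y t
      proof -
        have "mdist X x y \<le> g x + g y" using g(1) that by (simp add: K_def dominating_def)
        then show ?thesis using that by (simp add: K_def)
      qed
      moreover have "U \<subseteq> K" using \<open>V \<subseteq> K\<close> UV by blast
      moreover have "K \<subseteq> mspace X \<times> UNIV" by (auto simp: K_def)
      ultimately show ?thesis unfolding \<A>_def by blast
    qed
    ultimately have "K = V" using max by blast
    then have "(x, g x) \<in> V" using x by (auto simp: K_def)
    then show ?thesis using fle g(2) x by fastforce
  qed
  moreover have "f \<in> extensional (mspace X)" by (simp add: f_def)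
  ultimately have "f \<in> extremal_functions X"
    using domf unfolding extremal_functions_def by blast
  then show ?thesis by (rule that) (use fle UV in blast)
qed

lemma extremal_dom:
  "\<lbrakk>f \<in> extremal_functions X; x \<in> mspace X; y \<in> mspace X\<rbrakk> \<Longrightarrow> mdist X x y \<le> f x + f y"
  unfolding extremal_functions_def dominating_def by blast

lemma extremal_minimal:
  "\<lbrakk>f \<in> extremal_functions X; dominating X g; \<forall>x\<in>mspace X. g x \<le> f x; x \<in> mspace X\<rbrakk> \<Longrightarrow> g x = f x"
  unfolding extremal_functions_def by blast

lemma extremal_ext:
  assumes "f \<in> extremal_functions X" "g \<in> extremal_functions X" "\<And>x. x \<in> mspace X \<Longrightarrow> f x = g x"
  shows "f = g"
proof (rule extensionalityI[of _ "mspace X"])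
  show "f \<in> extensional (mspace X)" "g \<in> extensional (mspace X)"
    using assms(1,2) unfolding extremal_functions_def by blast+
qed (fact assms(3))

lemma extremal_nonneg: "\<lbrakk>f \<in> extremal_functions X; x \<in> mspace X\<rbrakk> \<Longrightarrow> 0 \<le> f x"
  using extremal_dom[of f X x x] by simp

lemma extremal_tight:
  assumes f: "f \<in> extremal_functions X" and x: "x \<in> mspace X" and \<epsilon>: "0 < \<epsilon>"
  obtains y where "y \<in> mspace X" "f x + f y < mdist X x y + \<epsilon>"
proof (rule ccontr)
  assume nt: "\<not> thesis"
  note witness = that
  have ge: "mdist X x y + \<epsilon> \<le> f x + f y" if y: "y \<in> mspace X" for y
    using witness[OF y] nt by force
  define g where "g = f(x := f x - \<epsilon>/2)"
  have "mdist X u v \<le> g u + g v" if "u \<in> mspace X" "v \<in> mspace X" for u v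
    using ge[of u] ge[of v] extremal_dom[OF f that] \<epsilon> that x mdist_zero[of x X x]
    by (auto simp: g_def mdist_commute)
  then have "dominating X g" by (auto simp: dominating_def)
  moreover have "\<forall>u\<in>mspace X. g u \<le> f u" using \<epsilon> by (auto simp: g_def)
  ultimately have "g x = f x" using extremal_minimal[OF f] x by blast
  then show False using \<epsilon> by (simp add: g_def)
qed

lemma extremal_lipschitz:
  assumes f: "f \<in> extremal_functions X" and xy: "x \<in> mspace X" "y \<in> mspace X"
  shows "f x \<le> f y + mdist X x y"
proof (rule field_le_epsilon)
  fix \<epsilon> :: real assume "0 < \<epsilon>"
  then obtain w where w: "w \<in> mspace X" "f x + f w < mdist X x w + \<epsilon>"
    using extremal_tight f xy by metis
  then show "f x \<le> f y + mdist X x y + \<epsilon>"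
    using mdist_triangle[of x X y w] extremal_dom[OF f xy(2) w(1)] xy by auto
qed

lemma extremal_le_swap:
  assumes f: "f \<in> extremal_functions X" and g: "g \<in> extremal_functions X"
    and le: "\<And>x. x \<in> mspace X \<Longrightarrow> f x \<le> g x + r" and x: "x \<in> mspace X"
  shows "g x \<le> f x + r"
proof (rule field_le_epsilon)
  fix \<epsilon> :: real assume "0 < \<epsilon>"
  then obtain y where y: "y \<in> mspace X" "g x + g y < mdist X x y + \<epsilon>"
    using extremal_tight g x by metis
  then show "g x \<le> f x + r + \<epsilon>" using extremal_dom[OF f x y(1)] le[OF y(1)] by auto
qed

context
  fixes X :: "'a metric"
  assumes ne: "mspace X \<noteq> {}"
begin

lemma extremal_dist_bound:
  assumes f: "f \<in> extremal_functions X" and g: "g \<in> extremal_functions X" and x: "x \<in> mspace X"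
  shows "\<bar>f x - g x\<bar> \<le> extremal_dist X f g"
proof -
  obtain a where a: "a \<in> mspace X" using ne by blast
  have "\<bar>f x - g x\<bar> \<le> f a + g a" if "x \<in> mspace X" for x
    using extremal_lipschitz[OF f that a] extremal_lipschitz[OF g that a]
      extremal_dom[OF f that a] extremal_dom[OF g that a] by auto
  then have "bdd_above ((\<lambda>x. \<bar>f x - g x\<bar>) ` mspace X)" by (auto intro!: bdd_aboveI[of _ "f a + g a"])
  then show ?thesis using f g x by (auto simp: extremal_dist_def intro: cSUP_upper)
qed

lemma extremal_dist_le:
  assumes f: "f \<in> extremal_functions X" and g: "g \<in> extremal_functions X"
    and le: "\<And>x. x \<in> mspace X \<Longrightarrow> f x \<le> g x + r"
  shows "extremal_dist X f g \<le> r"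
proof -
  have "\<bar>f x - g x\<bar> \<le> r" if "x \<in> mspace X" for x
    using le[OF that] extremal_le_swap[OF f g le that] by auto
  then show ?thesis using f g ne by (auto simp: extremal_dist_def intro: cSUP_least)
qed

lemma extremal_le_dist:
  "\<lbrakk>f \<in> extremal_functions X; g \<in> extremal_functions X; x \<in> mspace X\<rbrakk>
    \<Longrightarrow> f x \<le> g x + extremal_dist X f g"
  using extremal_dist_bound[of f g x] by auto

lemma Metric_space_extremal: "Metric_space (extremal_functions X) (extremal_dist X)"
proof
  obtain a where a: "a \<in> mspace X" using ne by blast
  show nonneg: "0 \<le> extremal_dist X f g" for f g
    using extremal_dist_bound[of f g a] a by (cases "f \<in> extremal_functions X \<and> g \<in> extremal_functions X")
      (auto simp: extremal_dist_def)
  show "extremal_dist X f g = extremal_dist X g f" for f g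
    by (auto simp: extremal_dist_def abs_minus_commute)
  show "extremal_dist X f g = 0 \<longleftrightarrow> f = g"
    if "f \<in> extremal_functions X" "g \<in> extremal_functions X" for f g
  proof
    assume "extremal_dist X f g = 0"
    then have "f x = g x" if "x \<in> mspace X" for x
      using extremal_dist_bound[of f g x] that \<open>f \<in> _\<close> \<open>g \<in> _\<close> by auto
    then show "f = g"
      using that by (intro extremal_ext)
  next
    assume "f = g"
    then have "extremal_dist X f g \<le> 0" using extremal_dist_le[of f g 0] that by auto
    then show "extremal_dist X f g = 0" using nonneg[of f g] by auto
  qed
  show "extremal_dist X f h \<le> extremal_dist X f g + extremal_dist X g h"
    if "f \<in> extremal_functions X" "g \<in> extremal_functions X" "h \<in> extremal_functions X" for f g h
    using that extremal_le_dist[of f g] extremal_le_dist[of g h]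
    by (intro extremal_dist_le) fastforce+
qed

lemma mspace_tight_span [simp]: "mspace (tight_span X) = extremal_functions X"
  by (simp add: tight_span_def Metric_space.mspace_metric[OF Metric_space_extremal])

lemma mdist_tight_span [simp]: "mdist (tight_span X) = extremal_dist X"
  by (simp add: tight_span_def Metric_space.mdist_metric[OF Metric_space_extremal])

lemma Kuratowski_extremal:
  assumes x: "x \<in> mspace X"
  shows "Kuratowski X x \<in> extremal_functions X"
proof -
  have "dominating X (Kuratowski X x)"
    using mdist_triangle[of _ X x] x mdist_commute[of X _ x]
    by (auto simp: dominating_def Kuratowski_def)
  moreover have "g y = Kuratowski X x y"
    if g: "dominating X g" "\<forall>y\<in>mspace X. g y \<le> Kuratowski X x y" and y: "y \<in> mspace X" for g y
  proof -
    have "mdist X x y \<le> g x + g y" using g x y by (auto simp: dominating_def)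
    moreover have "g x \<le> 0" "g y \<le> mdist X x y"
      using bspec[OF g(2) x] bspec[OF g(2) y] x y by (auto simp: Kuratowski_def)
    ultimately show ?thesis using y by (auto simp: Kuratowski_def)
  qed
  moreover have "Kuratowski X x \<in> extensional (mspace X)" by (simp add: Kuratowski_def)
  ultimately show ?thesis unfolding extremal_functions_def by blast
qed

lemma extremal_dist_Kuratowski:
  assumes x: "x \<in> mspace X" and f: "f \<in> extremal_functions X"
  shows "extremal_dist X f (Kuratowski X x) = f x"
proof (rule antisym)
  show "extremal_dist X f (Kuratowski X x) \<le> f x"
  proof (rule extremal_dist_le[OF f Kuratowski_extremal[OF x]])
    fix y assume y: "y \<in> mspace X"
    show "f y \<le> Kuratowski X x y + f x"
      using extremal_lipschitz[OF f y x] y mdist_commute[of X x y] by (simp add: Kuratowski_def)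
  qed
  show "f x \<le> extremal_dist X f (Kuratowski X x)"
    using extremal_le_dist[OF f Kuratowski_extremal[OF x] x] x by (simp add: Kuratowski_def)
qed

lemma Kuratowski_embedding: "isometric_embedding X (tight_span X) (Kuratowski X)"
  unfolding isometric_embedding_def mspace_tight_span mdist_tight_span
proof (intro conjI ballI)
  show "Kuratowski X \<in> mspace X \<rightarrow> extremal_functions X" using Kuratowski_extremal by auto
  fix x y assume x: "x \<in> mspace X" and y: "y \<in> mspace X"
  show "extremal_dist X (Kuratowski X x) (Kuratowski X y) = mdist X x y"
    using extremal_dist_Kuratowski[OF y Kuratowski_extremal[OF x]] y by (simp add: Kuratowski_def)
qed

lemma hyperconvex_tight_span: "hyperconvex (tight_span X)"
  unfolding hyperconvex_def mspace_tight_span mdist_tight_span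
proof (intro allI impI, elim conjE)
  fix \<B> assume sub: "\<B> \<subseteq> extremal_functions X \<times> UNIV" and "\<B> \<noteq> {}"
    and le: "\<forall>(f,r)\<in>\<B>. \<forall>(g,s)\<in>\<B>. extremal_dist X f g \<le> r + s"
  define U where "U = {(x, f x + r) | x f r. (f,r) \<in> \<B> \<and> x \<in> mspace X}"
  obtain h where h: "h \<in> extremal_functions X" "\<And>x s. (x,s) \<in> U \<Longrightarrow> h x \<le> s"
  proof (rule extremal_exists[of U X])
    show "U \<subseteq> mspace X \<times> UNIV" by (auto simp: U_def)
    show "\<exists>s. (x,s) \<in> U" if "x \<in> mspace X" for x
      using that \<open>\<B> \<noteq> {}\<close> unfolding U_def by fast
    show "mdist X x y \<le> s + t" if xy: "(x,s) \<in> U" "(y,t) \<in> U" for x s y t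
    proof -
      obtain f r g r' where fg: "(f,r) \<in> \<B>" "(g,r') \<in> \<B>" "s = f x + r" "t = g y + r'"
        "x \<in> mspace X" "y \<in> mspace X" using xy unfolding U_def by blast
      then have E: "f \<in> extremal_functions X" "g \<in> extremal_functions X" using sub by auto
      have "extremal_dist X f g \<le> r + r'" using le fg by blast
      then show ?thesis
        using extremal_le_dist[OF E(1,2) fg(6)] extremal_dom[OF E(1) fg(5,6)] fg
          Metric_space.commute[OF Metric_space_extremal, of f g] by auto
    qed
  qed blast
  have "extremal_dist X f h \<le> r" if "(f,r) \<in> \<B>" for f r
  proof -
    have f: "f \<in> extremal_functions X" using sub that by auto
    have "h x \<le> f x + r" if "x \<in> mspace X" for x
      using h(2)[of x "f x + r"] that \<open>(f,r) \<in> \<B>\<close> unfolding U_def by blast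
    then have "extremal_dist X h f \<le> r" using extremal_dist_le[OF h(1) f] by blast
    then show ?thesis using Metric_space.commute[OF Metric_space_extremal, of f h] by simp
  qed
  then show "\<exists>h\<in>extremal_functions X. \<forall>(f,r)\<in>\<B>. extremal_dist X f h \<le> r" using h by (intro bexI[of _ h]) auto
qed

lemma injective_tight_span: "injective_space (tight_span X)"
  by (rule hyperconvex_imp_injective[OF hyperconvex_tight_span])

lemma tight_span_factor:
  assumes Z: "injective_space Z" and i: "isometric_embedding X Z i"
  shows "\<exists>h. isometric_embedding (tight_span X) Z h \<and> (\<forall>x\<in>mspace X. h (Kuratowski X x) = i x)"
proof -
  let ?K = "Kuratowski X"
  have Kd: "mdist (tight_span X) (?K x) (?K y) = mdist X x y" if "x \<in> mspace X" "y \<in> mspace X" for x y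
    using Kuratowski_embedding that by (auto simp: isometric_embedding_def)
  have iX: "i x \<in> mspace Z" if "x \<in> mspace X" for x
    using i that by (auto simp: isometric_embedding_def)
  have inj: "inj_on ?K (mspace X)"
    by (rule inj_onI) (metis Kd mdist_zero mspace_tight_span Kuratowski_extremal)
  define g where "g = i \<circ> the_inv_into (mspace X) ?K"
  have g: "g (?K x) = i x" if "x \<in> mspace X" for x
    using that inj by (simp add: g_def the_inv_into_f_f)
  obtain h where h: "h \<in> mspace (tight_span X) \<rightarrow> mspace Z"
    "\<And>p q. \<lbrakk>p \<in> mspace (tight_span X); q \<in> mspace (tight_span X)\<rbrakk>
        \<Longrightarrow> mdist Z (h p) (h q) \<le> mdist (tight_span X) p q"
    "\<And>p. p \<in> ?K ` mspace X \<Longrightarrow> h p = g p"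
  proof (rule lipschitz_extension[OF injective_imp_hyperconvex[OF Z], of "?K ` mspace X" "tight_span X" g])
    show "g \<in> ?K ` mspace X \<rightarrow> mspace Z" using g iX by auto
    show "mdist Z (g p) (g q) \<le> mdist (tight_span X) p q"
      if pq: "p \<in> ?K ` mspace X" "q \<in> ?K ` mspace X" for p q
    proof -
      obtain x y where "x \<in> mspace X" "y \<in> mspace X" "p = ?K x" "q = ?K y" using pq by auto
      then show ?thesis using g Kd i by (simp add: isometric_embedding_def del: mdist_tight_span)
    qed
  qed (use ne Kuratowski_extremal in auto)
  have hK: "h (?K x) = i x" if "x \<in> mspace X" for x using h(3) g that by auto
  have hZ: "h p \<in> mspace Z" if "p \<in> extremal_functions X" for p using h(1) that by auto
  have hd: "mdist Z (h p) (i x) = p x" if p: "p \<in> extremal_functions X" and x: "x \<in> mspace X" for p x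
  proof -
    have "dominating X (\<lambda>x. mdist Z (h p) (i x))"
      unfolding dominating_def
    proof (intro ballI)
      fix x y assume xy: "x \<in> mspace X" "y \<in> mspace X"
      have "mdist X x y = mdist Z (i x) (i y)" using i xy by (auto simp: isometric_embedding_def)
      also have "\<dots> \<le> mdist Z (i x) (h p) + mdist Z (h p) (i y)"
        using xy iX hZ[OF p] by (intro mdist_triangle)
      finally show "mdist X x y \<le> mdist Z (h p) (i x) + mdist Z (h p) (i y)"
        by (simp add: mdist_commute)
    qed
    moreover have "\<forall>x\<in>mspace X. mdist Z (h p) (i x) \<le> p x"
    proof
      fix x assume x: "x \<in> mspace X"
      show "mdist Z (h p) (i x) \<le> p x"
        using h(2)[of p "?K x"] p Kuratowski_extremal[OF x] hK[OF x] extremal_dist_Kuratowski[OF x p]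
        by auto
    qed
    ultimately show ?thesis using extremal_minimal[OF p] x by blast
  qed
  have "mdist Z (h p) (h q) = extremal_dist X p q"
    if p: "p \<in> extremal_functions X" and q: "q \<in> extremal_functions X" for p q
  proof (rule antisym)
    show "mdist Z (h p) (h q) \<le> extremal_dist X p q" using h(2)[of p q] p q by auto
    show "extremal_dist X p q \<le> mdist Z (h p) (h q)"
    proof (rule extremal_dist_le[OF p q])
      fix x assume x: "x \<in> mspace X"
      show "p x \<le> q x + mdist Z (h p) (h q)"
        using mdist_triangle[OF hZ[OF p] hZ[OF q] iX[OF x]] hd[OF p x] hd[OF q x] by simp
    qed
  qed
  then show ?thesis using hZ hK by (intro exI[of _ h]) (auto simp: isometric_embedding_def)
qed

lemma injective_hull_tight_span: "injective_hull X (tight_span X) (Kuratowski X)"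
  unfolding injective_hull_def
proof (intro conjI allI impI)
  fix Z :: "('a \<Rightarrow> real) metric" and i
  assume "injective_space Z \<and> isometric_embedding X Z i"
  then show "\<exists>h. isometric_embedding (tight_span X) Z h \<and> (\<forall>x\<in>mspace X. h (Kuratowski X x) = i x)"
    by (intro tight_span_factor) simp_all
qed (fact injective_tight_span Kuratowski_embedding)+

end

lemma isometric_embedding_in:
  "\<lbrakk>isometric_embedding X Y f; x \<in> mspace X\<rbrakk> \<Longrightarrow> f x \<in> mspace Y"
  by (auto simp: isometric_embedding_def)

lemma isometric_embedding_mdist:
  "\<lbrakk>isometric_embedding X Y f; x \<in> mspace X; y \<in> mspace X\<rbrakk> \<Longrightarrow> mdist Y (f x) (f y) = mdist X x y"
  by (auto simp: isometric_embedding_def)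

lemma isometric_embedding_trans:
  "\<lbrakk>isometric_embedding X Y f; isometric_embedding Y Z g\<rbrakk> \<Longrightarrow> isometric_embedding X Z (g \<circ> f)"
  by (auto simp: isometric_embedding_def Pi_iff)

lemma injective_space_empty: "mspace X = {} \<Longrightarrow> injective_space X"
  unfolding injective_space_def geodesic_space_def
  by (intro conjI allI impI) auto

lemma injective_hullD:
  fixes X :: "'a metric"
  assumes "injective_hull X E e"
  shows "injective_space E" "isometric_embedding X E e"
    and "\<lbrakk>injective_space (Z :: ('a \<Rightarrow> real) metric); isometric_embedding X Z i\<rbrakk>
      \<Longrightarrow> \<exists>h. isometric_embedding E Z h \<and> (\<forall>x\<in>mspace X. h (e x) = i x)"
proof -
  note * = assms[unfolded injective_hull_def]
  show "injective_space E" using * by (rule conjunct1)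
  show "isometric_embedding X E e" using *[THEN conjunct2] by (rule conjunct1)
  show "\<exists>h. isometric_embedding E Z h \<and> (\<forall>x\<in>mspace X. h (e x) = i x)"
    if "injective_space Z" "isometric_embedding X Z i"
    using *[THEN conjunct2, THEN conjunct2, rule_format, OF conjI[OF that]] .
qed

theorem injective_hull_exists:
  "\<exists>(E :: ('a \<Rightarrow> real) metric) e. injective_hull (X :: 'a metric) E e"
proof (cases "mspace X = {}")
  case True
  define E where "E = submetric (undefined :: ('a \<Rightarrow> real) metric) {}"
  have "mspace E = {}" by (simp add: E_def)
  then have "injective_hull X E undefined"
    unfolding injective_hull_def using True
    by (intro conjI allI impI) (simp_all add: isometric_embedding_def injective_space_empty)
  then show ?thesis by blast
next
  case False
  then show ?thesis using injective_hull_tight_span[OF False] by blast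
qed

theorem injective_hull_factor:
  fixes X :: "'a metric" and E :: "'e metric" and Z :: "'z metric"
  assumes E: "injective_hull X E e" and Z: "injective_space Z" and i: "isometric_embedding X Z i"
  shows "\<exists>h. isometric_embedding E Z h \<and> (\<forall>x\<in>mspace X. h (e x) = i x)"
proof (cases "mspace X = {}")
  case True
  define Y where "Y = submetric (undefined :: ('a \<Rightarrow> real) metric) {}"
  have Y: "mspace Y = {}" by (simp add: Y_def)
  then have "isometric_embedding X Y undefined"
    using True by (auto simp: isometric_embedding_def)
  then obtain h where "isometric_embedding E Y h"
    using injective_hullD(3)[OF E injective_space_empty[OF Y]] by blast
  then have "mspace E = {}" using Y by (auto simp: isometric_embedding_def)
  then show ?thesis using True by (auto simp: isometric_embedding_def)
next
  case False
  obtain h where h: "isometric_embedding E (tight_span X) h" "\<forall>x\<in>mspace X. h (e x) = Kuratowski X x"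
    using injective_hullD(3)[OF E injective_tight_span[OF False] Kuratowski_embedding[OF False]]
    by blast
  obtain k where k: "isometric_embedding (tight_span X) Z k" "\<forall>x\<in>mspace X. k (Kuratowski X x) = i x"
    using tight_span_factor[OF False Z i] by blast
  show ?thesis
    using isometric_embedding_trans[OF h(1) k(1)] h(2) k(2) by (intro exI[of _ "k \<circ> h"]) auto
qed

text \<open>A point of the hull is determined by its distances to the points of \<open>X\<close>.\<close>

lemma injective_hull_points_eq:
  assumes E: "injective_hull X E e" and pq: "p \<in> mspace E" "q \<in> mspace E"
    and eq: "\<And>x. x \<in> mspace X \<Longrightarrow> mdist E p (e x) = mdist E q (e x)"
  shows "p = q"
proof (cases "mspace X = {}")
  case True
  have "isometric_embedding X (submetric E {}) e" "injective_space (submetric E {})"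
    using True by (auto simp: isometric_embedding_def intro: injective_space_empty)
  then obtain h where "isometric_embedding E (submetric E {}) h"
    using injective_hull_factor[OF E] by blast
  then show ?thesis using pq by (auto simp: isometric_embedding_def)
next
  case False
  obtain h where h: "isometric_embedding E (tight_span X) h" "\<forall>x\<in>mspace X. h (e x) = Kuratowski X x"
    using injective_hullD(3)[OF E injective_tight_span[OF False] Kuratowski_embedding[OF False]]
    by blast
  have e: "e x \<in> mspace E" if "x \<in> mspace X" for x
    using isometric_embedding_in[OF injective_hullD(2)[OF E] that] .
  have hE: "h r \<in> extremal_functions X" if "r \<in> mspace E" for r
    using isometric_embedding_in[OF h(1) that] False by simp
  have hd: "h r x = mdist E r (e x)" if "r \<in> mspace E" "x \<in> mspace X" for r x
  proof -
    have "mdist E r (e x) = mdist (tight_span X) (h r) (h (e x))"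
      using isometric_embedding_mdist[OF h(1) that(1) e[OF that(2)]] by simp
    then show ?thesis
      using h(2) that extremal_dist_Kuratowski[OF False that(2) hE[OF that(1)]] False by simp
  qed
  have "h p = h q"
    using hE[OF pq(1)] hE[OF pq(2)] by (rule extremal_ext) (use hd pq eq in simp)
  moreover have "mdist (tight_span X) (h p) (h q) = mdist E p q"
    using isometric_embedding_mdist[OF h(1) pq] .
  moreover have "mdist (tight_span X) (h q) (h q) = 0"
    using hE[OF pq(2)] False by (intro mdist_refl) simp
  ultimately have "mdist E p q = 0" by simp
  then show ?thesis using pq by simp
qed

theorem hull_isometry_ex1:
  assumes E: "injective_hull X E e" and \<phi>: "\<phi> \<in> Isom X"
  shows "\<exists>!\<Phi>. \<Phi> \<in> Isom E \<and> (\<forall>x\<in>mspace X. \<Phi> (e x) = e (\<phi> x))"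
proof -
  have inj: "injective_space E" and e: "isometric_embedding X E e"
    using injective_hullD[OF E] by blast+
  have eX: "e x \<in> mspace E" if "x \<in> mspace X" for x
    using isometric_embedding_in[OF e that] .
  have \<phi>': "isometric_embedding X X \<phi>" "bij_betw \<phi> (mspace X) (mspace X)"
    using \<phi> by (auto simp: Isom_def)
  have fixes_imp_id: "k p = p"
    if k: "isometric_embedding E E k" "\<And>x. x \<in> mspace X \<Longrightarrow> k (e x) = e x" and p: "p \<in> mspace E" for k p
  proof (rule injective_hull_points_eq[OF E _ p])
    show "k p \<in> mspace E" using isometric_embedding_in[OF k(1) p] .
    show "mdist E (k p) (e x) = mdist E p (e x)" if "x \<in> mspace X" for x
      using isometric_embedding_mdist[OF k(1) p eX[OF that]] k(2)[OF that] by simp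
  qed
  define \<psi> where "\<psi> = inv_into (mspace X) \<phi>"
  have \<psi>: "\<psi> x \<in> mspace X" "\<phi> (\<psi> x) = x" "\<psi> (\<phi> x) = x" "\<phi> x \<in> mspace X" if "x \<in> mspace X" for x
  proof -
    show "\<psi> x \<in> mspace X" using bij_betwE[OF bij_betw_inv_into[OF \<phi>'(2)]] that by (simp add: \<psi>_def)
    show "\<phi> (\<psi> x) = x" using bij_betw_inv_into_right[OF \<phi>'(2) that] by (simp add: \<psi>_def)
    show "\<psi> (\<phi> x) = x" using bij_betw_inv_into_left[OF \<phi>'(2) that] by (simp add: \<psi>_def)
    show "\<phi> x \<in> mspace X" using bij_betwE[OF \<phi>'(2)] that by blast
  qed
  have "isometric_embedding X X \<psi>"
    unfolding isometric_embedding_def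
  proof (intro conjI ballI)
    fix x y assume xy: "x \<in> mspace X" "y \<in> mspace X"
    show "mdist X (\<psi> x) (\<psi> y) = mdist X x y"
      using isometric_embedding_mdist[OF \<phi>'(1) \<psi>(1)[OF xy(1)] \<psi>(1)[OF xy(2)]] \<psi>(2) xy by simp
  qed (use \<psi> in auto)
  obtain h where h: "isometric_embedding E E h" "\<forall>x\<in>mspace X. h (e x) = (e \<circ> \<phi>) x"
    using injective_hull_factor[OF E inj isometric_embedding_trans[OF \<phi>'(1) e]] by blast
  obtain k where k: "isometric_embedding E E k" "\<forall>x\<in>mspace X. k (e x) = (e \<circ> \<psi>) x"
    using injective_hull_factor[OF E inj isometric_embedding_trans[OF \<open>isometric_embedding X X \<psi>\<close> e]]
    by blast
  have hk: "h (k p) = p" if "p \<in> mspace E" for p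
    using fixes_imp_id[OF isometric_embedding_trans[OF k(1) h(1)] _ that] h(2) k(2) \<psi> by simp
  have kh: "k (h p) = p" if "p \<in> mspace E" for p
    using fixes_imp_id[OF isometric_embedding_trans[OF h(1) k(1)] _ that] h(2) k(2) \<psi> by simp
  have hE: "h p \<in> mspace E" "k p \<in> mspace E" if "p \<in> mspace E" for p
    using isometric_embedding_in[OF h(1) that] isometric_embedding_in[OF k(1) that] by auto
  have "bij_betw h (mspace E) (mspace E)"
    by (rule bij_betw_byWitness[of _ k]) (use hk kh hE in auto)
  then have "bij_betw (restrict h (mspace E)) (mspace E) (mspace E)" by simp
  then have ex: "restrict h (mspace E) \<in> Isom E \<and>
      (\<forall>x\<in>mspace X. restrict h (mspace E) (e x) = e (\<phi> x))"
    using h hE eX by (auto simp: Isom_def isometric_embedding_def)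
  moreover have "\<Phi> = restrict h (mspace E)"
    if \<Phi>: "\<Phi> \<in> Isom E \<and> (\<forall>x\<in>mspace X. \<Phi> (e x) = e (\<phi> x))" for \<Phi>
  proof (rule extensionalityI[of _ "mspace E"])
    fix p assume p: "p \<in> mspace E"
    have \<Phi>E: "isometric_embedding E E \<Phi>" using \<Phi> by (auto simp: Isom_def)
    have "k (\<Phi> p) = p"
      using fixes_imp_id[OF isometric_embedding_trans[OF \<Phi>E k(1)] _ p] \<Phi> k(2) \<psi> by simp
    moreover have "\<Phi> p \<in> mspace E" using isometric_embedding_in[OF \<Phi>E p] .
    ultimately show "\<Phi> p = restrict h (mspace E) p" using hk[of "\<Phi> p"] p by simp
  qed (use \<Phi> in \<open>auto simp: Isom_def\<close>)
  ultimately show ?thesis by blast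
qed

end

theory Submission
  imports Defs
begin

text \<open>The space \<open>X\<close> need not contain geodesics, and its quasigeodesics need not be continuous. What replaces
  a geodesic from \<open>x\<close> to \<open>y\<close> is the set of points \<open>z\<close> with \<open>d x z + d z y\<close> at most \<open>d x y\<close> plus a constant; such
  points are said to lie between \<open>x\<close> and \<open>y\<close>, and weak rough geodesicity provides them at every distance
  from \<open>x\<close>.

  From the four-point condition to quasihyperbolicity, the content is the Morse lemma: points between
  the ends of a quasigeodesic are near it (\<open>Morse_between\<close>), and its points are between its ends
  (\<open>quasigeodesic_between\<close>). Then triangles of quasigeodesics are thin, because by the four-point
  condition a point between two vertices is between one of them and the third vertex.

  Conversely, in a quasihyperbolic space, the crucial fact is that the points of a quasigeodesic
  lie between its ends with a uniform tolerance (\<open>excess_bounded\<close>). This fails for general metrics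
  quasiisometric to a hyperbolic one, and it is here that weak rough geodesicity enters. Once it is known,
  Gromov products are coarsely distances to quasigeodesics, and thinness of triangles becomes the
  four-point condition.

  Both arguments have the same form. Repeated halving gives an error that is logarithmic in the
  length of the segment. On the other hand, if the error is at most \<open>R\<close>, then it can be estimated on a
  subsegment of length linear in \<open>R\<close>. Hence a bound \<open>R\<close> implies a bound of the order of the logarithm of \<open>R\<close>,
  in particular \<open>a + R/2\<close> with a constant \<open>a\<close>, and therefore a bound \<open>2 * a + 1\<close> (\<open>halving_bound\<close>).

  For the hull, points of \<open>E\<close> are extremal functions on \<open>X\<close>, and under the four-point condition each of
  them is close to a distance function (\<open>extremal_near_Kuratowski\<close>). So the embedding of \<open>X\<close> in \<open>E\<close> itself
  is a rough isometry, and it is equivariant by the definition of the extended isometries. In the other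
  direction, both properties are pulled back along a rough isometry to \<open>E\<close>, which is geodesic.\<close>

section \<open>Bounds that improve themselves, and coarse connectedness\<close>

text \<open>This is how a bound that is finite but not uniform becomes uniform: \<open>P r\<close> says that \<open>r\<close> is an upper
  bound for some quantity, and the resulting bound \<open>2 * a + 1\<close> no longer mentions the initial one.\<close>

lemma halving_bound:
  fixes P :: "real \<Rightarrow> bool"
  assumes start: "P r\<^sub>0" and mono: "\<And>r s. \<lbrakk>P r; r \<le> s\<rbrakk> \<Longrightarrow> P s"
    and step: "\<And>r. \<lbrakk>0 \<le> r; P r\<rbrakk> \<Longrightarrow> P (a + r/2)" and a: "0 \<le> a"
  shows "P (2*a + 1)"
proof -
  have *: "P (2*a + \<bar>r\<^sub>0\<bar> / 2^n)" for n
  proof (induction n)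
    case 0
    show ?case using a by (auto intro: mono[OF start])
  next
    case (Suc n)
    have "a + (2*a + \<bar>r\<^sub>0\<bar> / 2^n)/2 = 2*a + \<bar>r\<^sub>0\<bar> / 2^Suc n" by (simp add: field_simps)
    moreover have "P (a + (2*a + \<bar>r\<^sub>0\<bar> / 2^n)/2)" using a by (intro step[OF _ Suc]) simp
    ultimately show ?case by metis
  qed
  obtain n where "\<bar>r\<^sub>0\<bar> < 2^n" using real_arch_pow[of 2 "\<bar>r\<^sub>0\<bar>"] by auto
  then have "\<bar>r\<^sub>0\<bar> / 2^n \<le> 1" by simp
  then show ?thesis by (intro mono[OF *[of n]]) simp
qed

text \<open>The exponent \<open>n\<close> plays the role of a binary logarithm of \<open>L\<close>: repeated halving costs \<open>c * n\<close>, which any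
  linear function of \<open>L\<close> dominates up to a constant.\<close>

lemma logarithm_absorbed:
  fixes c \<epsilon> :: real
  assumes c: "0 \<le> c" and \<epsilon>: "0 < \<epsilon>"
  obtains a where "0 \<le> a" "\<And>L. 0 \<le> L \<Longrightarrow> \<exists>n. L \<le> 2^n \<and> c * real n \<le> a + \<epsilon> * L"
proof -
  obtain k where k: "2*c/\<epsilon> < 2^k" using real_arch_pow[of 2 "2*c/\<epsilon>"] by auto
  have ck: "2*c \<le> \<epsilon> * 2^k" using k \<epsilon> by (simp add: field_simps)
  have lin: "c * real n \<le> c * real k + \<epsilon>/2 * 2^n" for n
  proof (cases "n \<le> k")
    case True
    then have "c * real n \<le> c * real k" using c by (intro mult_left_mono) auto
    moreover have "0 \<le> \<epsilon>/2 * 2^n" using \<epsilon> by simp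
    ultimately show ?thesis by linarith
  next
    case False
    then obtain j where j: "n = k + j" by (metis nat_le_iff_add nat_le_linear)
    have j2: "real j \<le> 2^j" using of_nat_less_two_power[of j, where 'a=real] by linarith
    have "c * real j \<le> (\<epsilon>/2 * 2^k) * 2^j"
      using ck c j2 by (intro mult_mono) auto
    then show ?thesis by (simp add: j power_add algebra_simps)
  qed
  show thesis
  proof (rule that)
    show "0 \<le> c * real k" using c by simp
    fix L :: real assume L: "0 \<le> L"
    define n where "n = (LEAST n. L \<le> 2^n)"
    obtain n0 where "L < 2^n0" using real_arch_pow[of 2 L] by auto
    then have n: "L \<le> 2^n" unfolding n_def using LeastI[of "\<lambda>n. L \<le> 2^n" n0] by simp
    have "c * real n \<le> c * real k + \<epsilon> * L"
    proof (cases n)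
      case 0
      then show ?thesis using c L \<epsilon> by simp
    next
      case (Suc j)
      then have "\<not> L \<le> 2^j" using not_less_Least[of j "\<lambda>n. L \<le> 2^n"] by (simp add: n_def)
      then have "2^n \<le> 2*L" using Suc by simp
      then have "\<epsilon>/2 * 2^n \<le> \<epsilon> * L" using \<epsilon> by simp
      then show ?thesis using lin[of n] by linarith
    qed
    with n show "\<exists>n. L \<le> 2^n \<and> c * real n \<le> c * real k + \<epsilon> * L" by blast
  qed
qed

text \<open>Quasigeodesics need not be continuous, so intermediate-value arguments are run on their parameter
  intervals.\<close>

lemma interval_coarsely_connected:
  fixes a b :: real
  assumes ab: "a \<le> b" and cover: "\<And>t. t \<in> {a..b} \<Longrightarrow> A t \<or> B t" and "A a" "B b"
  obtains s t where "s \<in> {a..b}" "t \<in> {a..b}" "A s" "B t" "\<bar>s - t\<bar> \<le> 1"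
proof -
  let ?V = "{t\<in>{a..b}. A t}"
  define u where "u = Sup ?V"
  have ne: "?V \<noteq> {}" using ab \<open>A a\<close> by auto
  have bdd: "bdd_above ?V" by (auto intro: bdd_aboveI[of _ b])
  obtain s where s: "s \<in> ?V" "u - 1/2 < s"
    using less_cSupD[OF ne, of "u - 1/2"] by (auto simp: u_def)
  have le: "r \<le> u" if "r \<in> ?V" for r unfolding u_def by (rule cSup_upper[OF that bdd])
  have "u \<le> b" unfolding u_def by (rule cSup_least[OF ne]) auto
  define t where "t = min b (u + 1/2)"
  have t: "t \<in> {a..b}" "s \<le> t" "t \<le> u + 1/2" using s le[OF s(1)] \<open>u \<le> b\<close> by (auto simp: t_def)
  have "B t"
  proof (cases "t = b")
    case False
    then have "u < t" by (auto simp: t_def)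
    then have "\<not> A t" using le[of t] t by force
    then show ?thesis using cover[OF t(1)] by blast
  qed (use \<open>B b\<close> in simp)
  then show thesis using that[of s t] s t by auto
qed

section \<open>Quasigeodesics and Gromov products\<close>

lemma quasigeodesic_sideE:
  assumes "quasigeodesic_side X q x y S"
  obtains a b c where "a \<le> b" "c a = x" "c b = y" "S = c ` {a..b}" "1 \<le> q"
    "\<And>t. t \<in> {a..b} \<Longrightarrow> c t \<in> mspace X"
    "\<And>s t. \<lbrakk>s \<in> {a..b}; t \<in> {a..b}\<rbrakk> \<Longrightarrow> \<bar>s - t\<bar> \<le> q * (mdist X (c s) (c t) + q)"
    "\<And>s t. \<lbrakk>s \<in> {a..b}; t \<in> {a..b}\<rbrakk> \<Longrightarrow> mdist X (c s) (c t) \<le> q * \<bar>s - t\<bar> + q"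
proof -
  obtain a b :: real and c where abc: "a \<le> b" "c a = x" "c b = y" "S = c ` {a..b}"
    and c: "quasi_isometric_embedding (submetric euclidean_metric {a..b}) X q q c"
    using assms unfolding quasigeodesic_side_def by blast
  have q: "1 \<le> q" using c by (simp add: quasi_isometric_embedding_def)
  show thesis
  proof (rule that[OF abc q])
    show "c t \<in> mspace X" if "t \<in> {a..b}" for t
      using c that by (auto simp: quasi_isometric_embedding_def)
    fix s t assume st: "s \<in> {a..b}" "t \<in> {a..b}"
    have *: "\<bar>s - t\<bar> / q - q \<le> mdist X (c s) (c t) \<and> mdist X (c s) (c t) \<le> q * \<bar>s - t\<bar> + q"
      using c st by (simp add: quasi_isometric_embedding_def dist_real_def)
    then show "mdist X (c s) (c t) \<le> q * \<bar>s - t\<bar> + q" by simp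
    have "\<bar>s - t\<bar> / q \<le> mdist X (c s) (c t) + q" using * by linarith
    then show "\<bar>s - t\<bar> \<le> q * (mdist X (c s) (c t) + q)"
      using q by (simp add: pos_divide_le_eq mult.commute)
  qed
qed

lemma quasigeodesic_sideD:
  assumes "quasigeodesic_side X q x y S"
  shows "x \<in> S" "y \<in> S" "S \<subseteq> mspace X" "1 \<le> q"
  using assms by (auto elim!: quasigeodesic_sideE)

lemma quasigeodesic_side_reverse:
  assumes "quasigeodesic_side X q x y S"
  shows "quasigeodesic_side X q y x S"
proof -
  obtain a b :: real and c where abc: "a \<le> b" "c a = x" "c b = y" "S = c ` {a..b}"
    and c: "quasi_isometric_embedding (submetric euclidean_metric {a..b}) X q q c"
    using assms unfolding quasigeodesic_side_def by blast
  define \<rho> where "\<rho> t = a + b - t" for t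
  have \<rho>: "\<rho> t \<in> {a..b}" "\<rho> (\<rho> t) = t" if "t \<in> {a..b}" for t
    using that by (auto simp: \<rho>_def)
  have "\<rho> ` {a..b} = {a..b}"
    using image_diff_atLeastAtMost[of "a + b" a b] by (simp add: \<rho>_def[abs_def])
  then have "S = (c \<circ> \<rho>) ` {a..b}"
    by (simp only: abc(4) image_comp[symmetric])
  moreover have "quasi_isometric_embedding (submetric euclidean_metric {a..b}) X q q (c \<circ> \<rho>)"
    unfolding quasi_isometric_embedding_def
  proof (intro conjI ballI)
    show "1 \<le> q" "0 \<le> q" using c by (simp_all add: quasi_isometric_embedding_def)
    show "c \<circ> \<rho> \<in> mspace (submetric euclidean_metric {a..b}) \<rightarrow> mspace X"
      using c \<rho>(1) by (auto simp: quasi_isometric_embedding_def)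
    let ?I = "submetric euclidean_metric {a..b}"
    fix s t assume st: "s \<in> mspace ?I" "t \<in> mspace ?I"
    have "mdist ?I (\<rho> s) (\<rho> t) = mdist ?I s t" by (simp add: \<rho>_def dist_real_def)
    moreover have "\<rho> s \<in> mspace ?I" "\<rho> t \<in> mspace ?I" using st \<rho>(1) by simp_all
    ultimately show "mdist ?I s t / q - q \<le> mdist X ((c \<circ> \<rho>) s) ((c \<circ> \<rho>) t)"
      "mdist X ((c \<circ> \<rho>) s) ((c \<circ> \<rho>) t) \<le> q * mdist ?I s t + q"
      using c unfolding quasi_isometric_embedding_def comp_apply by metis+
  qed
  moreover have "(c \<circ> \<rho>) a = y" "(c \<circ> \<rho>) b = x" using abc by (auto simp: \<rho>_def)
  ultimately show ?thesis
    unfolding quasigeodesic_side_def using abc(1)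
    by (intro exI[of _ a] exI[of _ b] exI[of _ "c \<circ> \<rho>"] conjI)
qed

lemma Gromov_product_commute: "Gromov_product X w x y = Gromov_product X w y x"
  by (simp add: Gromov_product_def mdist_commute)

lemma Gromov_product_ge:
  assumes "u \<in> mspace X" "v \<in> mspace X" "w \<in> mspace X"
  shows "mdist X u w - mdist X u v \<le> Gromov_product X w u v"
  using mdist_triangle[of u X v w] assms by (simp add: Gromov_product_def field_simps)

section \<open>The Morse lemma from the four-point condition\<close>

text \<open>Throughout, a point \<open>m\<close> is regarded as lying between \<open>x\<close> and \<open>y\<close> when
  \<open>d x m + d m y \<le> d x y + 2 * K\<close>, that is, when the Gromov product of \<open>x\<close> and \<open>y\<close> at \<open>m\<close> is at most \<open>K\<close>.\<close>

locale hyperbolic_weakly_roughly_geodesic =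
  fixes X :: "'a metric" and \<delta> C :: real
  assumes \<delta>_nonneg: "0 \<le> \<delta>" and C_nonneg: "0 \<le> C"
    and four_point: "\<lbrakk>w \<in> mspace X; x \<in> mspace X; y \<in> mspace X; z \<in> mspace X\<rbrakk>
      \<Longrightarrow> min (Gromov_product X w x y) (Gromov_product X w y z) - \<delta> \<le> Gromov_product X w x z"
    and roughly_between: "\<lbrakk>x \<in> mspace X; y \<in> mspace X; 0 \<le> r; r \<le> mdist X x y\<rbrakk>
      \<Longrightarrow> \<exists>z\<in>mspace X. mdist X x z \<le> r + C \<and> mdist X z y \<le> (mdist X x y - r) + C"
begin

abbreviation d where "d \<equiv> mdist X"
abbreviation gp where "gp \<equiv> Gromov_product X"

lemma four_point_sum:
  assumes "w \<in> mspace X" "x \<in> mspace X" "y \<in> mspace X" "z \<in> mspace X"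
  shows "d w z + d x y \<le> d x w + d z y + 2*\<delta> \<or> d w z + d x y \<le> d x z + d w y + 2*\<delta>"
  using four_point[OF assms(3) assms(1) assms(2) assms(4)] mdist_commute[of X w x]
  by (auto simp: Gromov_product_def min_def field_simps split: if_splits)

text \<open>Points between \<open>x\<close> and \<open>y\<close> are coarsely determined by their distance from \<open>x\<close>, as on a geodesic.\<close>

lemma between_points_close:
  assumes M: "x \<in> mspace X" "y \<in> mspace X" "m \<in> mspace X" "m' \<in> mspace X"
    and m: "d x m + d m y \<le> d x y + 2*K" and m': "d x m' + d m' y \<le> d x y + 2*K"
  shows "d m m' \<le> \<bar>d x m - d x m'\<bar> + 2*K + 2*\<delta>"
proof -
  have "d m m' + d x y \<le> d x m + d m' y + 2*\<delta> \<or> d m m' + d x y \<le> d x m' + d m y + 2*\<delta>"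
    using four_point_sum[OF M(3,1,2,4)] .
  moreover have "d x m - d x m' \<le> \<bar>d x m - d x m'\<bar>" "d x m' - d x m \<le> \<bar>d x m - d x m'\<bar>" by linarith+
  ultimately show ?thesis using m m' by argo
qed

text \<open>Iterating the four-point condition along a binary subdivision of the chain loses \<open>\<delta>\<close> only once per
  level. This logarithmic loss is the source of the Morse lemma: a chain whose ends are seen from \<open>m\<close> in
  opposite directions must come within about \<open>n * \<delta>\<close> of \<open>m\<close>, while its length may be as large as \<open>2^n\<close>.\<close>

lemma small_product_in_chain:
  assumes "0 < N" "N \<le> 2^n" "m \<in> mspace X" "\<And>i. i \<le> N \<Longrightarrow> p i \<in> mspace X"
  shows "\<exists>i<N. gp m (p i) (p (Suc i)) \<le> gp m (p 0) (p N) + real n * \<delta>"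
  using assms
proof (induction n arbitrary: N p)
  case 0
  then have "N = 1" by simp
  then show ?case by auto
next
  case (Suc n)
  show ?case
  proof (cases "N = 1")
    case True
    then show ?thesis using \<delta>_nonneg by auto
  next
    case False
    define j where "j = N div 2"
    have j: "0 < j" "j < N" "j \<le> 2^n" "N - j \<le> 2^n" using False Suc.prems(1,2) by (auto simp: j_def)
    have split: "gp m (p 0) (p j) \<le> gp m (p 0) (p N) + \<delta> \<or> gp m (p j) (p N) \<le> gp m (p 0) (p N) + \<delta>"
      using four_point[of m "p 0" "p j" "p N"] Suc.prems(3,4) j by fastforce
    then show ?thesis
    proof
      assume *: "gp m (p 0) (p j) \<le> gp m (p 0) (p N) + \<delta>"
      obtain i where "i < j" "gp m (p i) (p (Suc i)) \<le> gp m (p 0) (p j) + real n * \<delta>"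
        using Suc.IH[of j p] j Suc.prems(3,4) by auto
      then show ?thesis using * j by (intro exI[of _ i]) (auto simp: algebra_simps)
    next
      assume *: "gp m (p j) (p N) \<le> gp m (p 0) (p N) + \<delta>"
      obtain i where "i < N - j" "gp m (p (j + i)) (p (j + Suc i)) \<le> gp m (p j) (p N) + real n * \<delta>"
        using Suc.IH[of "N - j" "\<lambda>i. p (j + i)"] j Suc.prems(3,4) by auto
      then show ?thesis using * j by (intro exI[of _ "j + i"]) (auto simp: algebra_simps)
    qed
  qed
qed

text \<open>Suppose that points between \<open>x\<close> and \<open>y\<close> are within \<open>R\<close> of \<open>S\<close>. To look at \<open>S\<close> near \<open>m\<close> only, one needs a
  point of \<open>S\<close> on the \<open>x\<close>-side of \<open>m\<close> whose distance from \<open>m\<close> is linear in \<open>R\<close>. Being on the \<open>x\<close>-side is expressed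
  by a large product of \<open>x\<close> and \<open>p\<close> at \<open>m\<close>; the threshold exceeds \<open>C + 2 * \<delta>\<close> because both ends are to be
  replaced by such points, one after the other, each time at the cost of \<open>\<delta>\<close>.\<close>

lemma between_anchor:
  assumes M: "x \<in> mspace X" "y \<in> mspace X" "m \<in> mspace X" and S: "S \<subseteq> mspace X" "x \<in> S"
    and m: "d x m + d m y \<le> d x y + 2*C" and R: "0 \<le> R"
    and near: "\<And>z. \<lbrakk>z \<in> mspace X; d x z + d z y \<le> d x y + 2*C\<rbrakk> \<Longrightarrow> \<exists>p\<in>S. d z p \<le> R"
  shows "\<exists>p\<in>S. d p m \<le> 2*R + 5*C + 4*\<delta> + 1 \<and> (p = x \<or> C + 2*\<delta> + 1 \<le> gp m x p)"
proof (cases "d x m \<le> R + 2*C + 2*\<delta> + 1")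
  case True
  then show ?thesis using S R C_nonneg \<delta>_nonneg by (intro bexI[of _ x]) auto
next
  case False
  \<comment> \<open>Step back from \<open>m\<close> towards \<open>x\<close> by slightly more than the radius \<open>R\<close> in which a point of \<open>S\<close>
    is known to exist, so that this point stays on the \<open>x\<close>-side.\<close>
  define r where "r = d x m - (R + 2*C + 2*\<delta> + 1)"
  have "0 \<le> r" "r \<le> d x y"
    using False m R C_nonneg \<delta>_nonneg mdist_nonneg[of X m y] unfolding r_def by linarith+
  then obtain z where z: "z \<in> mspace X" "d x z \<le> r + C" "d z y \<le> d x y - r + C"
    using roughly_between[OF M(1,2)] by blast
  then have zb: "d x z + d z y \<le> d x y + 2*C" by simp
  obtain p where p: "p \<in> S" "d z p \<le> R" using near[OF z(1) zb] by blast
  have pM: "p \<in> mspace X" using S p by blast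
  have "r - C \<le> d x z" using mdist_triangle[OF M(1) z(1) M(2)] z(3) by linarith
  then have "d m z \<le> R + 5*C + 4*\<delta> + 1"
    using between_points_close[OF M(1,2,3) z(1) m zb] z(2) R C_nonneg \<delta>_nonneg
    unfolding r_def by linarith
  then have "d p m \<le> 2*R + 5*C + 4*\<delta> + 1"
    using mdist_triangle[OF pM z(1) M(3)] p(2) mdist_commute[of X p z] mdist_commute[of X z m] by linarith
  moreover have "d x p \<le> r + C + R" using mdist_triangle[OF M(1) z(1) pM] z(2) p(2) by linarith
  then have "C + 2*\<delta> + 1 \<le> gp m x p"
    using mdist_triangle[OF M(1) z(1) M(3)] mdist_triangle[OF M(1) pM M(3)]
      mdist_triangle[OF z(1) pM M(3)] z(2) p(2)
    unfolding Gromov_product_def r_def by (simp add: field_simps)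
  ultimately show ?thesis using p(1) by blast
qed

text \<open>One half of the Morse lemma: points between the ends are near the quasigeodesic. For a single
  quasigeodesic some bound \<open>R\<close> exists, for trivial reasons. The anchors on both sides of \<open>m\<close> are then at
  distance linear in \<open>R\<close>, hence so is the length of the part of the quasigeodesic between them, and
  \<open>small_product_in_chain\<close> brings this part within a logarithm of \<open>R\<close> from \<open>m\<close>. Thus \<open>R\<close> may be replaced by
  \<open>A + R/2\<close>, where \<open>A\<close> depends on the constants only, and \<open>halving_bound\<close> makes the bound uniform.\<close>

lemma Morse_between:
  assumes q: "1 \<le> q"
  shows "\<exists>R\<ge>0. \<forall>x y S m. quasigeodesic_side X q x y S \<and> m \<in> mspace X \<and> d x m + d m y \<le> d x y + 2*C
    \<longrightarrow> (\<exists>p\<in>S. d m p \<le> R)"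
proof -
  define B where "B = 5*C + 4*\<delta> + 1"
  have B0: "0 \<le> B" using C_nonneg \<delta>_nonneg by (simp add: B_def)
  obtain a\<^sub>0 where a0: "0 \<le> a\<^sub>0" and
    a: "\<And>L. 0 \<le> L \<Longrightarrow> \<exists>n. L \<le> 2^n \<and> \<delta> * real n \<le> a\<^sub>0 + 1/(8*q) * L"
    using logarithm_absorbed[of \<delta> "1/(8*q)"] \<delta>_nonneg q
    by (metis less_le_trans mult_pos_pos zero_less_divide_1_iff zero_less_numeral zero_less_one)
  define A where "A = C + 2*\<delta> + 2*q + a\<^sub>0 + (q*(2*B + q) + 1)/(8*q)"
  have A0: "0 \<le> A"
    unfolding A_def using C_nonneg \<delta>_nonneg q a0 B0 by (intro add_nonneg_nonneg divide_nonneg_nonneg) auto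
  have "\<exists>p\<in>S. d m p \<le> 2*A + 1"
    if side: "quasigeodesic_side X q x y S" and m: "m \<in> mspace X" "d x m + d m y \<le> d x y + 2*C" for x y S m
  proof -
    obtain a b c where ab: "a \<le> b" and c: "c a = x" "c b = y" and Sc: "S = c ` {a..b}" "1 \<le> q"
      and cM: "\<And>t. t \<in> {a..b} \<Longrightarrow> c t \<in> mspace X"
      and lower: "\<And>s t. \<lbrakk>s \<in> {a..b}; t \<in> {a..b}\<rbrakk> \<Longrightarrow> \<bar>s - t\<bar> \<le> q * (d (c s) (c t) + q)"
      and upper: "\<And>s t. \<lbrakk>s \<in> {a..b}; t \<in> {a..b}\<rbrakk> \<Longrightarrow> d (c s) (c t) \<le> q * \<bar>s - t\<bar> + q"
      by (rule quasigeodesic_sideE[OF side]) blast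
    note S = quasigeodesic_sideD[OF side]
    have xy: "x \<in> mspace X" "y \<in> mspace X" using S by auto
    define P where "P R \<longleftrightarrow> (\<forall>m\<in>mspace X. d x m + d m y \<le> d x y + 2*C \<longrightarrow> (\<exists>p\<in>S. d m p \<le> R))" for R
    have "P (2*A + 1)"
    proof (rule halving_bound[OF _ _ _ A0])
      show "P (d x y + 2*C)"
        unfolding P_def
      proof (intro ballI impI)
        fix m assume "m \<in> mspace X" "d x m + d m y \<le> d x y + 2*C"
        then show "\<exists>p\<in>S. d m p \<le> d x y + 2*C"
          using S mdist_nonneg[of X m y] mdist_commute[of X m x] by (intro bexI[of _ x]) linarith+
      qed
      show "P s" if "P r" "r \<le> s" for r s using that unfolding P_def by (meson order_trans)
      fix R assume R: "0 \<le> R" and PR: "P R"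
      show "P (A + R/2)"
        unfolding P_def
      proof (intro ballI impI)
        fix m assume m: "m \<in> mspace X" "d x m + d m y \<le> d x y + 2*C"
        have near: "\<exists>p\<in>S. d z p \<le> R" if "z \<in> mspace X" "d x z + d z y \<le> d x y + 2*C" for z
          using PR that unfolding P_def by blast
        obtain p\<^sub>1 where p1: "p\<^sub>1 \<in> S" "d p\<^sub>1 m \<le> 2*R + B" "p\<^sub>1 = x \<or> C + 2*\<delta> + 1 \<le> gp m x p\<^sub>1"
          using between_anchor[OF xy m(1) S(3,1) m(2) R near] unfolding B_def by (auto simp: add.assoc)
        obtain p\<^sub>2 where p2: "p\<^sub>2 \<in> S" "d p\<^sub>2 m \<le> 2*R + B" "p\<^sub>2 = y \<or> C + 2*\<delta> + 1 \<le> gp m y p\<^sub>2"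
        proof -
          have "\<exists>p\<in>S. d z p \<le> R" if "z \<in> mspace X" "d y z + d z x \<le> d y x + 2*C" for z
            using near[OF that(1)] that(2) mdist_commute[of X y z] mdist_commute[of X z x] mdist_commute[of X y x] by simp
          moreover have "d y m + d m x \<le> d y x + 2*C"
            using m(2) mdist_commute[of X y m] mdist_commute[of X m x] mdist_commute[of X y x] by simp
          ultimately show thesis
            using between_anchor[OF xy(2,1) m(1) S(3,2) _ R] that unfolding B_def by (auto simp: add.assoc)
        qed
        have pM: "p\<^sub>1 \<in> mspace X" "p\<^sub>2 \<in> mspace X" using S p1 p2 by auto
        have gxy: "gp m x y \<le> C" using m(2) mdist_commute[of X m y] by (simp add: Gromov_product_def)
        have g1: "gp m p\<^sub>1 y \<le> C + \<delta>"
          using four_point[OF m(1) xy(1) pM(1) xy(2)] gxy p1(3) \<delta>_nonneg by auto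
        have g2: "gp m p\<^sub>1 p\<^sub>2 \<le> C + 2*\<delta>"
          using four_point[OF m(1) pM xy(2)] g1 p2(3) \<delta>_nonneg Gromov_product_commute[of X m y p\<^sub>2] by auto
        obtain s t where s: "s \<in> {a..b}" "p\<^sub>1 = c s" and t: "t \<in> {a..b}" "p\<^sub>2 = c t"
          using p1 p2 Sc(1) by blast
        have "d p\<^sub>1 p\<^sub>2 \<le> 2*(2*R + B)"
          using mdist_triangle[OF pM(1) m(1) pM(2)] p1(2) p2(2) mdist_commute[of X m p\<^sub>2] by argo
        then have "q * (d (c s) (c t) + q) \<le> q * (2*(2*R + B) + q)"
          using s t q by (intro mult_left_mono) auto
        then have st: "\<bar>s - t\<bar> \<le> q * (2*(2*R + B) + q)" using lower[OF s(1) t(1)] by linarith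
        \<comment> \<open>Between the anchors, the quasigeodesic is cut at unit steps of the parameter, so that consecutive
          points are within \<open>2 * q\<close>. The coefficient \<open>1/(8*q)\<close> above turns the term \<open>4 * q * R\<close> of \<open>L\<close> into \<open>R/2\<close>.\<close>
        define L where "L = q * (2*(2*R + B) + q) + 1"
        have "0 \<le> L" using st unfolding L_def by linarith
        then obtain n where n: "L \<le> 2^n" "\<delta> * real n \<le> a\<^sub>0 + 1/(8*q) * L" using a by blast
        define N where "N = nat \<lfloor>\<bar>s - t\<bar>\<rfloor> + 1"
        have N: "0 < N" "\<bar>s - t\<bar> \<le> real N" "real N \<le> L" using st unfolding N_def L_def by linarith+
        then have "real N \<le> 2^n" using n(1) by linarith
        then have N2: "N \<le> 2^n" by simp
        define \<tau> where "\<tau> i = s + (t - s) * (real i / real N)" for i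
        have \<tau>: "\<tau> i \<in> {a..b}" if "i \<le> N" for i
        proof -
          have f: "0 \<le> real i / real N" "real i / real N \<le> 1" using that N by auto
          have "\<tau> i = (1 - real i / real N) *\<^sub>R s + (real i / real N) *\<^sub>R t"
            by (simp add: \<tau>_def algebra_simps diff_divide_distrib)
          also have "\<dots> \<in> {a..b}" using f s(1) t(1) by (intro convexD) (auto simp: convex_real_interval)
          finally show ?thesis .
        qed
        have "\<exists>i<N. gp m (c (\<tau> i)) (c (\<tau> (Suc i))) \<le> gp m (c (\<tau> 0)) (c (\<tau> N)) + real n * \<delta>"
          using small_product_in_chain[OF N(1) N2 m(1), of "\<lambda>i. c (\<tau> i)"] cM \<tau> by blast
        moreover have "c (\<tau> 0) = p\<^sub>1" "c (\<tau> N) = p\<^sub>2" using N s t by (simp_all add: \<tau>_def)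
        ultimately obtain i where i: "i < N" "gp m (c (\<tau> i)) (c (\<tau> (Suc i))) \<le> C + 2*\<delta> + real n * \<delta>"
          using g2 by fastforce
        have "\<bar>\<tau> i - \<tau> (Suc i)\<bar> = \<bar>s - t\<bar> / real N"
          using N
          by (simp add: \<tau>_def abs_mult diff_divide_distrib[symmetric] right_diff_distrib[symmetric] abs_minus_commute)
        also have "\<dots> \<le> 1" using N by simp
        finally have "q * \<bar>\<tau> i - \<tau> (Suc i)\<bar> \<le> q * 1" using q by (intro mult_left_mono) auto
        then have "d (c (\<tau> i)) (c (\<tau> (Suc i))) \<le> 2*q"
          using upper[OF \<tau> \<tau>, of i "Suc i"] i(1) by simp
        then have "d (c (\<tau> i)) m \<le> C + 2*\<delta> + real n * \<delta> + 2*q"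
          using Gromov_product_ge[OF cM[OF \<tau>] cM[OF \<tau>] m(1), of i "Suc i"] i by simp
        also have "\<dots> \<le> C + 2*\<delta> + 2*q + a\<^sub>0 + 1/(8*q) * L" using n(2) by (simp add: mult.commute)
        also have "\<dots> = A + R/2" using q by (simp add: A_def L_def field_simps)
        finally show "\<exists>p\<in>S. d m p \<le> A + R/2"
          using \<tau>[of i] i(1) Sc(1) mdist_commute[of X m] by (intro bexI[of _ "c (\<tau> i)"]) auto
      qed
    qed
    then show ?thesis using m unfolding P_def by blast
  qed
  then show ?thesis using A0 by (intro exI[of _ "2*A + 1"]) auto
qed

text \<open>A larger tolerance \<open>K\<close> costs nothing new: by \<open>between_points_close\<close> the point \<open>m\<close> is close to a point with
  tolerance \<open>C\<close> at about the same distance from \<open>x\<close>.\<close>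

lemma near_quasigeodesic_if_between:
  assumes q: "1 \<le> q" and K: "0 \<le> K"
  shows "\<exists>R\<ge>0. \<forall>x y S m. quasigeodesic_side X q x y S \<and> m \<in> mspace X \<and> d x m + d m y \<le> d x y + 2*K
    \<longrightarrow> (\<exists>p\<in>S. d m p \<le> R)"
proof -
  obtain R where R: "0 \<le> R" "\<And>x y S m. \<lbrakk>quasigeodesic_side X q x y S; m \<in> mspace X;
      d x m + d m y \<le> d x y + 2*C\<rbrakk> \<Longrightarrow> \<exists>p\<in>S. d m p \<le> R"
    using Morse_between[OF q] by blast
  have "\<exists>p\<in>S. d m p \<le> R + 5*C + 4*K + 2*\<delta>"
    if side: "quasigeodesic_side X q x y S" and m: "m \<in> mspace X" "d x m + d m y \<le> d x y + 2*K" for x y S m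
  proof -
    note S = quasigeodesic_sideD[OF side]
    have xy: "x \<in> mspace X" "y \<in> mspace X" using S by auto
    define r where "r = min (d x m) (d x y)"
    have r: "0 \<le> r" "r \<le> d x y" "r \<le> d x m" "d x m \<le> r + 2*K"
      using m(2) K mdist_nonneg[of X m y] mdist_nonneg[of X x m] mdist_nonneg[of X x y]
      unfolding r_def by linarith+
    obtain z where z: "z \<in> mspace X" "d x z \<le> r + C" "d z y \<le> d x y - r + C"
      using roughly_between[OF xy r(1,2)] by blast
    have "r - C \<le> d x z" using mdist_triangle[OF xy(1) z(1) xy(2)] z(3) by linarith
    moreover have "d m z \<le> \<bar>d x m - d x z\<bar> + 2*(K + C) + 2*\<delta>"
      using between_points_close[OF xy m(1) z(1), of "K + C"] m(2) z K C_nonneg by auto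
    moreover have "\<bar>d x m - d x z\<bar> \<le> 2*K + C"
      using calculation(1) r z(2) K C_nonneg by (simp add: abs_le_iff)
    ultimately have "d m z \<le> 5*C + 4*K + 2*\<delta>" using C_nonneg by simp
    moreover obtain p where p: "p \<in> S" "d z p \<le> R" using R(2)[OF side z(1)] z by auto
    moreover have "p \<in> mspace X" using p(1) S by blast
    ultimately show ?thesis using mdist_triangle[of m X z p] m(1) z(1) by (intro bexI[of _ p]) auto
  qed
  then show ?thesis using R(1) K C_nonneg \<delta>_nonneg by (intro exI[of _ "R + 5*C + 4*K + 2*\<delta>"]) auto
qed

text \<open>The other half of the Morse lemma. Move a point \<open>z\<close> between \<open>x\<close> and \<open>y\<close> from \<open>x\<close> to \<open>y\<close>. It stays close to
  the quasigeodesic and changes from being close to the part before \<open>p\<close> to being close to the part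
  after \<open>p\<close>. Where the change occurs, the two parts come close to each other, so the parameters are close,
  and \<open>p\<close>, which is caught in between, is close to \<open>z\<close>.\<close>

lemma quasigeodesic_between:
  assumes q: "1 \<le> q"
  shows "\<exists>K\<ge>0. \<forall>x y S p. quasigeodesic_side X q x y S \<and> p \<in> S \<longrightarrow> d x p + d p y \<le> d x y + 2*K"
proof -
  obtain R where R: "0 \<le> R" "\<And>x y S m. \<lbrakk>quasigeodesic_side X q x y S; m \<in> mspace X;
      d x m + d m y \<le> d x y + 2*C\<rbrakk> \<Longrightarrow> \<exists>p\<in>S. d m p \<le> R"
    using Morse_between[OF q] by blast
  \<comment> \<open>\<open>D\<close> bounds the distance of the two parts at the change, and \<open>K - C\<close> that of \<open>p\<close> from \<open>z\<close>.\<close>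
  define D where "D = 2*R + 4*C + 1 + 2*\<delta>"
  define K where "K = R + q * (q * (D + q)) + q + C"
  have D0: "0 \<le> D" using R C_nonneg \<delta>_nonneg by (simp add: D_def)
  have K0: "0 \<le> K" using R C_nonneg D0 q by (simp add: K_def)
  have "d x p + d p y \<le> d x y + 2*K" if side: "quasigeodesic_side X q x y S" and p: "p \<in> S" for x y S p
  proof -
    obtain a b c where ab: "a \<le> b" and c: "c a = x" "c b = y" and Sc: "S = c ` {a..b}" "1 \<le> q"
      and cM: "\<And>t. t \<in> {a..b} \<Longrightarrow> c t \<in> mspace X"
      and lower: "\<And>s t. \<lbrakk>s \<in> {a..b}; t \<in> {a..b}\<rbrakk> \<Longrightarrow> \<bar>s - t\<bar> \<le> q * (d (c s) (c t) + q)"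
      and upper: "\<And>s t. \<lbrakk>s \<in> {a..b}; t \<in> {a..b}\<rbrakk> \<Longrightarrow> d (c s) (c t) \<le> q * \<bar>s - t\<bar> + q"
      by (rule quasigeodesic_sideE[OF side]) blast
    note S = quasigeodesic_sideD[OF side]
    have xy: "x \<in> mspace X" "y \<in> mspace X" and pM: "p \<in> mspace X" using S p by auto
    obtain u where u: "u \<in> {a..b}" "p = c u" using p Sc(1) by blast
    define Z where "Z r z \<longleftrightarrow> z \<in> mspace X \<and> d x z \<le> r + C \<and> d z y \<le> d x y - r + C" for r z
    define near where "near I r \<longleftrightarrow> (\<exists>z s. Z r z \<and> s \<in> I \<and> d z (c s) \<le> R)" for I r
    obtain r r' where r: "r \<in> {0..d x y}" "r' \<in> {0..d x y}" "near {a..u} r" "near {u..b} r'" "\<bar>r - r'\<bar> \<le> 1"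
    proof (rule interval_coarsely_connected[of 0 "d x y" "near {a..u}" "near {u..b}"])
      fix r assume r: "r \<in> {0..d x y}"
      obtain z where z: "Z r z" using roughly_between[OF xy, of r] r unfolding Z_def by auto
      then obtain p where "p \<in> S" "d z p \<le> R" using R(2)[OF side, of z] unfolding Z_def by auto
      then obtain s where "s \<in> {a..b}" "d z (c s) \<le> R" using Sc(1) by blast
      then show "near {a..u} r \<or> near {u..b} r"
        using z unfolding near_def by (metis atLeastAtMost_iff nle_le)
    next
      show "near {a..u} 0" unfolding near_def
        using u xy c R C_nonneg by (intro exI[of _ x] exI[of _ a]) (auto simp: Z_def)
      show "near {u..b} (d x y)" unfolding near_def
        using u xy c R C_nonneg by (intro exI[of _ y] exI[of _ b]) (auto simp: Z_def)
    qed auto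
    obtain z s where z: "Z r z" and s: "s \<in> {a..u}" "d z (c s) \<le> R" using r unfolding near_def by blast
    obtain z' s' where z': "Z r' z'" and s': "s' \<in> {u..b}" "d z' (c s') \<le> R" using r unfolding near_def by blast
    have sI: "s \<in> {a..b}" "s' \<in> {a..b}" using s s' u by auto
    have zM: "z \<in> mspace X" "z' \<in> mspace X" using z z' by (auto simp: Z_def)
    have "d z z' \<le> \<bar>d x z - d x z'\<bar> + 2*C + 2*\<delta>"
      using z z' by (intro between_points_close[OF xy]) (auto simp: Z_def)
    moreover have "r - C \<le> d x z" "r' - C \<le> d x z'"
      using mdist_triangle[OF xy(1) zM(1) xy(2)] mdist_triangle[OF xy(1) zM(2) xy(2)] z z'
      unfolding Z_def by linarith+
    ultimately have "d z z' \<le> 4*C + 1 + 2*\<delta>" using z z' r(5) unfolding Z_def by linarith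
    then have "d (c s) (c s') \<le> D"
      using mdist_triangle[OF cM[OF sI(1)] zM(1) cM[OF sI(2)]] mdist_triangle[OF zM cM[OF sI(2)]]
        s(2) s'(2) mdist_commute[of X z "c s"] unfolding D_def by linarith
    then have "q * (d (c s) (c s') + q) \<le> q * (D + q)" using q by (intro mult_left_mono) auto
    then have "\<bar>s - u\<bar> \<le> q * (D + q)" using lower[OF sI] s s' by simp
    then have "q * \<bar>s - u\<bar> \<le> q * (q * (D + q))" using q by (intro mult_left_mono) auto
    then have "d (c s) p \<le> q * (q * (D + q)) + q" using upper[OF sI(1) u(1)] u(2) by simp
    then have "d z p \<le> K - C"
      using mdist_triangle[OF zM(1) cM[OF sI(1)] pM] s(2) unfolding K_def by linarith
    then show ?thesis
      using mdist_triangle[OF xy(1) zM(1) pM] mdist_triangle[OF pM zM(1) xy(2)]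
        mdist_commute[of X p z] z unfolding Z_def by linarith
  qed
  then show ?thesis using K0 by blast
qed

text \<open>A point on one side is between the ends of that side. By the four-point condition it is then between
  the ends of one of the other two sides, hence near it.\<close>

lemma quasigeodesic_triangles_thin:
  assumes q: "1 \<le> q"
  shows "\<exists>\<epsilon>. \<forall>x\<in>mspace X. \<forall>y\<in>mspace X. \<forall>z\<in>mspace X. \<forall>S T U.
        quasigeodesic_side X q x y S \<longrightarrow> quasigeodesic_side X q y z T \<longrightarrow>
        quasigeodesic_side X q z x U \<longrightarrow> thin_triangle X \<epsilon> S T U"
proof -
  obtain K where K: "0 \<le> K" "\<And>x y S p. \<lbrakk>quasigeodesic_side X q x y S; p \<in> S\<rbrakk> \<Longrightarrow> d x p + d p y \<le> d x y + 2*K"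
    using quasigeodesic_between[OF q] by blast
  have "0 \<le> K + \<delta>" using K \<delta>_nonneg by simp
  then obtain R where R: "0 \<le> R" "\<And>x y S m. \<lbrakk>quasigeodesic_side X q x y S; m \<in> mspace X;
      d x m + d m y \<le> d x y + 2*(K + \<delta>)\<rbrakk> \<Longrightarrow> \<exists>p\<in>S. d m p \<le> R"
    using near_quasigeodesic_if_between[OF q] by meson
  have side: "S \<subseteq> nbhd X R (T \<union> U)"
    if S: "quasigeodesic_side X q x y S" and T: "quasigeodesic_side X q y z T"
      and U: "quasigeodesic_side X q z x U" for x y z S T U
  proof
    fix p assume p: "p \<in> S"
    note SM = quasigeodesic_sideD[OF S] and TM = quasigeodesic_sideD[OF T] and UM = quasigeodesic_sideD[OF U]
    have M: "x \<in> mspace X" "y \<in> mspace X" "z \<in> mspace X" "p \<in> mspace X" using SM TM p by auto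
    have "gp p x y \<le> K" using K(2)[OF S p] by (simp add: Gromov_product_def mdist_commute[of X y])
    then have "gp p x z \<le> K + \<delta> \<or> gp p z y \<le> K + \<delta>" using four_point[OF M(4) M(1) M(3) M(2)] by auto
    then have "d z p + d p x \<le> d z x + 2*(K + \<delta>) \<or> d y p + d p z \<le> d y z + 2*(K + \<delta>)"
      by (auto simp: Gromov_product_def mdist_commute)
    then obtain u where u: "u \<in> T \<union> U" "d p u \<le> R" using R(2)[OF U M(4)] R(2)[OF T M(4)] by blast
    then have "u \<in> mspace X" using TM UM by blast
    then show "p \<in> nbhd X R (T \<union> U)"
      unfolding nbhd_def using u M(4) by (auto simp: mdist_commute intro!: bexI[of _ u])
  qed
  show ?thesis
    unfolding thin_triangle_def by (intro exI[of _ R]) (meson side)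
qed

text \<open>Points between \<open>x\<close> and \<open>y\<close> at distance about \<open>r\<close> from \<open>x\<close>, for \<open>r\<close> from \<open>0\<close> to \<open>d x y\<close>, form a rough geodesic, by
  \<open>between_points_close\<close>.\<close>

lemma quasigeodesic_space: "\<exists>q\<ge>1. quasigeodesic_space X q"
proof -
  define q where "q = 1 + 4*C + 2*\<delta>"
  have q: "1 \<le> q" using C_nonneg \<delta>_nonneg by (simp add: q_def)
  have "\<exists>S. quasigeodesic_side X q x y S" if xy: "x \<in> mspace X" "y \<in> mspace X" for x y
  proof -
    define Z where "Z r z \<longleftrightarrow> z \<in> mspace X \<and> d x z \<le> r + C \<and> d z y \<le> d x y - r + C" for r z
    define c where "c r = (if r = 0 then x else if r = d x y then y else SOME z. Z r z)" for r
    have c: "Z r (c r)" if r: "r \<in> {0..d x y}" for r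
    proof -
      have "\<exists>z. Z r z" using roughly_between[OF xy, of r] r unfolding Z_def by auto
      then have "Z r (SOME z. Z r z)" by (rule someI_ex)
      moreover have "Z 0 x" "Z (d x y) y" using xy C_nonneg by (auto simp: Z_def)
      ultimately show ?thesis unfolding c_def by (simp split: if_split)
    qed
    have c0: "c 0 = x" "c (d x y) = y" using xy by (auto simp: c_def)
    have diff: "\<bar>r - s\<bar> - 2*C \<le> d (c r) (c s) \<and> d (c r) (c s) \<le> \<bar>r - s\<bar> + 4*C + 2*\<delta>"
      if rs: "r \<in> {0..d x y}" "s \<in> {0..d x y}" for r s
    proof -
      note Zr = c[OF rs(1), unfolded Z_def] and Zs = c[OF rs(2), unfolded Z_def]
      have M: "c r \<in> mspace X" "c s \<in> mspace X" using Zr Zs by auto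
      have "r - C \<le> d x (c r)" "s - C \<le> d x (c s)"
        using mdist_triangle[OF xy(1) M(1) xy(2)] mdist_triangle[OF xy(1) M(2) xy(2)] Zr Zs by linarith+
      moreover have "d (c r) (c s) \<le> \<bar>d x (c r) - d x (c s)\<bar> + 2*C + 2*\<delta>"
        using Zr Zs by (intro between_points_close[OF xy M]) auto
      moreover have "d x (c s) \<le> d x (c r) + d (c r) (c s)" "d x (c r) \<le> d x (c s) + d (c r) (c s)"
        using mdist_triangle[OF xy(1) M] mdist_triangle[OF xy(1) M(2,1)] mdist_commute[of X "c r"] by auto
      ultimately show ?thesis using Zr Zs by linarith
    qed
    have "quasi_isometric_embedding (submetric euclidean_metric {0..d x y}) X q q c"
      unfolding quasi_isometric_embedding_def
    proof (intro conjI ballI)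
      show "c \<in> mspace (submetric euclidean_metric {0..d x y}) \<rightarrow> mspace X" using c by (auto simp: Z_def)
      fix r s assume "r \<in> mspace (submetric euclidean_metric {0..d x y})" "s \<in> mspace (submetric euclidean_metric {0..d x y})"
      then have rs: "r \<in> {0..d x y}" "s \<in> {0..d x y}" by auto
      have "\<bar>r - s\<bar> / q \<le> \<bar>r - s\<bar> / 1" using q by (intro divide_left_mono) auto
      moreover have "1 * \<bar>r - s\<bar> \<le> q * \<bar>r - s\<bar>" using q by (intro mult_right_mono) auto
      ultimately show "mdist (submetric euclidean_metric {0..d x y}) r s / q - q \<le> d (c r) (c s)"
        "d (c r) (c s) \<le> q * mdist (submetric euclidean_metric {0..d x y}) r s + q"
        using diff[OF rs] C_nonneg \<delta>_nonneg by (simp_all add: dist_real_def q_def)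
    qed (use q in auto)
    then show ?thesis unfolding quasigeodesic_side_def using c0
      by (intro exI[of _ "c ` {0..d x y}"] exI[of _ 0] exI[of _ "d x y"] exI[of _ c]) auto
  qed
  then show ?thesis unfolding quasigeodesic_space_def using q by blast
qed

lemma quasihyperbolic: "quasihyperbolic X"
  unfolding quasihyperbolic_def using quasigeodesic_space quasigeodesic_triangles_thin by blast

end

section \<open>The four-point condition from thin triangles\<close>

text \<open>This is twice the Gromov product of \<open>x\<close> and \<open>z\<close> at \<open>p\<close>; the order of the arguments is that on a path
  from \<open>x\<close> through \<open>p\<close> to \<open>z\<close>.\<close>

definition path_excess :: "'a metric \<Rightarrow> 'a \<Rightarrow> 'a \<Rightarrow> 'a \<Rightarrow> real" where
  "path_excess X x p z = mdist X x p + mdist X p z - mdist X x z"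

lemma path_excess_reverse: "path_excess X x p z = path_excess X z p x"
  by (simp add: path_excess_def mdist_commute)

text \<open>The reduction step of the following arguments: the end \<open>z\<close> is replaced by a point \<open>w\<close> between \<open>x\<close> and \<open>z\<close>,
  and \<open>p\<close> by a nearby point \<open>p'\<close> on a quasigeodesic from \<open>x\<close> to \<open>w\<close>.\<close>

lemma path_excess_move:
  assumes "x \<in> mspace X" "z \<in> mspace X" "p \<in> mspace X" "p' \<in> mspace X" "w \<in> mspace X"
    and "mdist X p p' \<le> \<epsilon>" "mdist X x w + mdist X w z \<le> mdist X x z + \<eta>"
  shows "path_excess X x p z \<le> path_excess X x p' w + 2*\<epsilon> + \<eta>"
  using mdist_triangle[of x X p' p] mdist_triangle[of p X p' z] mdist_triangle[of p' X w z] assms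
    mdist_commute[of X p p'] unfolding path_excess_def by simp

locale thin_weakly_roughly_geodesic =
  fixes X :: "'a metric" and q \<delta> C :: real
  assumes q: "1 \<le> q" and \<delta>_nonneg: "0 \<le> \<delta>" and C_nonneg: "0 \<le> C"
    and joined: "\<lbrakk>x \<in> mspace X; y \<in> mspace X\<rbrakk> \<Longrightarrow> \<exists>S. quasigeodesic_side X q x y S"
    and thin: "\<lbrakk>quasigeodesic_side X q x z U; quasigeodesic_side X q x y S; quasigeodesic_side X q y z T; p \<in> U\<rbrakk>
      \<Longrightarrow> (\<exists>p'\<in>S. mdist X p p' \<le> \<delta>) \<or> (\<exists>p'\<in>T. mdist X p p' \<le> \<delta>)"
    and roughly_between: "\<lbrakk>x \<in> mspace X; y \<in> mspace X; 0 \<le> r; r \<le> mdist X x y\<rbrakk>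
      \<Longrightarrow> \<exists>z\<in>mspace X. mdist X x z \<le> r + C \<and> mdist X z y \<le> (mdist X x y - r) + C"
begin

abbreviation d where "d \<equiv> mdist X"
abbreviation gp where "gp \<equiv> Gromov_product X"
abbreviation excess where "excess \<equiv> path_excess X"

text \<open>Halve the segment by a point \<open>m\<close> between its ends. The triangle with vertices \<open>x\<close>, \<open>m\<close>, \<open>z\<close> being thin, \<open>p\<close> is close
  to a point on a quasigeodesic whose ends are half as far apart, and the excess changes by a constant.
  The bound \<open>2^n + 2 * C\<close> is chosen because it is reproduced by \<open>t \<mapsto> t/2 + C\<close>.\<close>

lemma excess_logarithmic:
  "\<exists>c\<ge>0. \<forall>n x z U p. quasigeodesic_side X q x z U \<and> p \<in> U \<and> d x z \<le> 2^n + 2*C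
     \<longrightarrow> excess x p z \<le> c * (real n + 1)"
proof -
  define c where "c = max (2 * (q * (q * (1 + 2*C + q)) + q)) (2*\<delta> + 2*C)"
  have c: "2 * (q * (q * (1 + 2*C + q)) + q) \<le> c" "2*\<delta> + 2*C \<le> c" by (auto simp: c_def)
  have "excess x p z \<le> c * (real n + 1)"
    if "quasigeodesic_side X q x z U" "p \<in> U" "d x z \<le> 2^n + 2*C" for n x z U p
    using that
  proof (induction n arbitrary: x z U p)
    case 0
    obtain a b c' where ab: "a \<le> b" and c': "c' a = x" "c' b = z" and Uc: "U = c' ` {a..b}" "1 \<le> q"
      and cM: "\<And>t. t \<in> {a..b} \<Longrightarrow> c' t \<in> mspace X"
      and lower: "\<And>s t. \<lbrakk>s \<in> {a..b}; t \<in> {a..b}\<rbrakk> \<Longrightarrow> \<bar>s - t\<bar> \<le> q * (d (c' s) (c' t) + q)"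
      and upper: "\<And>s t. \<lbrakk>s \<in> {a..b}; t \<in> {a..b}\<rbrakk> \<Longrightarrow> d (c' s) (c' t) \<le> q * \<bar>s - t\<bar> + q"
      by (rule quasigeodesic_sideE[OF 0(1)]) blast
    obtain t where t: "t \<in> {a..b}" "p = c' t" using 0(2) Uc(1) by blast
    have "q * (d x z + q) \<le> q * (1 + 2*C + q)" using 0(3) q by (intro mult_left_mono) auto
    then have "\<bar>b - a\<bar> \<le> q * (1 + 2*C + q)" using lower[of a b] ab c' by simp
    then have "q * \<bar>s - t\<bar> \<le> q * (q * (1 + 2*C + q))" if "s \<in> {a,b}" for s
      using that t(1) q by (intro mult_left_mono) auto
    then have "d (c' s) p \<le> q * (q * (1 + 2*C + q)) + q" if "s \<in> {a,b}" for s
      using upper[of s t] that t ab by fastforce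
    from this[of a] this[of b] have "d x p + d p z \<le> 2 * (q * (q * (1 + 2*C + q)) + q)"
      using c' mdist_commute[of X p z] by simp
    then have "excess x p z \<le> 2 * (q * (q * (1 + 2*C + q)) + q)"
      using mdist_nonneg[of X x z] unfolding path_excess_def by linarith
    then show ?case using c(1) by simp
  next
    case (Suc n)
    note U = quasigeodesic_sideD[OF Suc.prems(1)]
    have M: "x \<in> mspace X" "z \<in> mspace X" "p \<in> mspace X" using U Suc.prems(2) by auto
    obtain m where m: "m \<in> mspace X" "d x m \<le> d x z/2 + C" "d m z \<le> d x z/2 + C"
      using roughly_between[OF M(1,2), of "d x z/2"] by auto
    obtain S T where S: "quasigeodesic_side X q x m S" and T: "quasigeodesic_side X q m z T"
      using joined m(1) M by blast
    have half: "d x m \<le> 2^n + 2*C" "d m z \<le> 2^n + 2*C" using m Suc.prems(3) by auto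
    have sum: "d x m + d m z \<le> d x z + 2*C" using m by simp
    consider p' where "p' \<in> S" "d p p' \<le> \<delta>" | p' where "p' \<in> T" "d p p' \<le> \<delta>"
      using thin[OF Suc.prems(1) S T Suc.prems(2)] by blast
    then have "excess x p z \<le> c * (real n + 1) + 2*\<delta> + 2*C"
    proof cases
      case (1 p')
      then have "p' \<in> mspace X" using quasigeodesic_sideD[OF S] by blast
      then have "excess x p z \<le> excess x p' m + 2*\<delta> + 2*C"
        using path_excess_move[OF M _ m(1) 1(2) sum] by blast
      then show ?thesis using Suc.IH[OF S 1(1) half(1)] by simp
    next
      case (2 p')
      then have "p' \<in> mspace X" using quasigeodesic_sideD[OF T] by blast
      moreover have "d z m + d m x \<le> d z x + 2*C" using sum by (simp add: mdist_commute)
      ultimately have "excess z p x \<le> excess z p' m + 2*\<delta> + 2*C"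
        using path_excess_move[OF M(2,1,3) _ m(1) 2(2)] by blast
      then show ?thesis using Suc.IH[OF T 2(1) half(2)] path_excess_reverse[of X x p z]
          path_excess_reverse[of X m p' z] by simp
    qed
    then show ?case using c(2) by (simp add: algebra_simps)
  qed
  moreover have "0 \<le> c" using c(2) \<delta>_nonneg C_nonneg by linarith
  ultimately show ?thesis by blast
qed

text \<open>A bound \<open>\<Phi>\<close> for the excess makes it possible to move the end \<open>z\<close> towards \<open>p\<close> until its distance from \<open>p\<close> is linear in
  \<open>\<Phi>\<close>. Choose \<open>w\<close> between \<open>x\<close> and \<open>z\<close> whose distance from \<open>z\<close> is smaller than that of \<open>p\<close> by more than \<open>\<Phi>\<close>.
  Then \<open>p\<close> cannot be close to a quasigeodesic from \<open>w\<close> to \<open>z\<close>, whose points are at most \<open>\<Phi>\<close> farther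
  from \<open>z\<close> than \<open>w\<close> is; so it is close to one from \<open>x\<close> to \<open>w\<close>. The bound \<open>D\<close> on the distances is
  preserved, so that \<open>\<Phi>\<close> can be improved for a fixed \<open>D\<close>.\<close>

lemma excess_shorten:
  assumes bound: "\<forall>x z U p. quasigeodesic_side X q x z U \<longrightarrow> p \<in> U \<longrightarrow> d x z \<le> D \<longrightarrow> excess x p z \<le> \<Phi>"
    and \<Phi>: "0 \<le> \<Phi>" and U: "quasigeodesic_side X q x z U" "p \<in> U" "d x z \<le> D"
  shows "\<exists>w S p'. quasigeodesic_side X q x w S \<and> p' \<in> S \<and> d p p' \<le> \<delta> \<and> d x w \<le> D \<and>
    d p' w \<le> 2*\<Phi> + 2*C + 2*\<delta> + 1 \<and> excess x p z \<le> excess x p' w + 2*\<delta> + 2*C"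
proof -
  define A where "A = \<Phi> + C + \<delta> + 1"
  have M: "x \<in> mspace X" "z \<in> mspace X" "p \<in> mspace X" using quasigeodesic_sideD[OF U(1)] U(2) by auto
  show ?thesis
  proof (cases "d p z \<le> A + C")
    case True
    then show ?thesis using U \<delta>_nonneg C_nonneg \<Phi> M
      by (intro exI[of _ z] exI[of _ U] exI[of _ p]) (auto simp: A_def)
  next
    case False
    have ex: "d x p + d p z \<le> d x z + \<Phi>" using bound[rule_format, OF U] by (simp add: path_excess_def)
    define r where "r = d x z - d p z + A"
    have r: "0 \<le> r" "r \<le> d x z" "r + C \<le> d x z"
      using False ex mdist_nonneg[of X x p] C_nonneg \<delta>_nonneg unfolding r_def A_def by linarith+
    obtain w where w: "w \<in> mspace X" "d x w \<le> r + C" "d w z \<le> d x z - r + C"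
      using roughly_between[OF M(1,2) r(1,2)] by blast
    obtain S T where S: "quasigeodesic_side X q x w S" and T: "quasigeodesic_side X q w z T"
      using joined w(1) M by blast
    have "\<not> (\<exists>p'\<in>T. d p p' \<le> \<delta>)"
    proof
      assume "\<exists>p'\<in>T. d p p' \<le> \<delta>"
      then obtain p' where p': "p' \<in> T" "d p p' \<le> \<delta>" by blast
      have p'M: "p' \<in> mspace X" using p'(1) quasigeodesic_sideD[OF T] by blast
      have "d w z \<le> D" using w(3) U(3) ex mdist_nonneg[of X x p] \<delta>_nonneg unfolding r_def A_def by linarith
      then have "d w p' + d p' z \<le> d w z + \<Phi>" using bound[rule_format, OF T p'(1)] by (simp add: path_excess_def)
      then show False
        using mdist_triangle[OF M(3) p'M M(2)] p'(2) w(3) mdist_nonneg[of X w p'] unfolding r_def A_def by linarith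
    qed
    then obtain p' where p': "p' \<in> S" "d p p' \<le> \<delta>" using thin[OF U(1) S T U(2)] by blast
    have p'M: "p' \<in> mspace X" using p'(1) quasigeodesic_sideD[OF S] by blast
    have xw: "d x w \<le> D" using w(2) r(3) U(3) by linarith
    have "d x p' + d p' w \<le> d x w + \<Phi>" using bound[rule_format, OF S p'(1) xw] by (simp add: path_excess_def)
    then have "d p' w \<le> 2*\<Phi> + 2*C + 2*\<delta> + 1"
      using w(2) mdist_triangle[OF M(1) p'M M(3)] mdist_triangle[OF M(1) M(3) M(2)] p'(2) mdist_commute[of X p p']
      unfolding r_def A_def by linarith
    moreover have "excess x p z \<le> excess x p' w + 2*\<delta> + 2*C"
      using path_excess_move[OF M p'M w(1) p'(2)] w(2,3) by simp
    ultimately show ?thesis using S p' xw by blast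
  qed
qed

text \<open>Moving both ends towards \<open>p\<close> leaves ends at distance linear in \<open>\<Phi>\<close>, where the excess is at most
  logarithmic in \<open>\<Phi>\<close> by \<open>excess_logarithmic\<close>. So the bound \<open>\<Phi>\<close> may be replaced by \<open>A + \<Phi>/2\<close>, where \<open>A\<close> does
  not depend on \<open>D\<close>. An initial bound for fixed \<open>D\<close> is the logarithmic one.\<close>

lemma excess_bounded:
  "\<exists>K\<ge>0. \<forall>x z U p. quasigeodesic_side X q x z U \<and> p \<in> U \<longrightarrow> excess x p z \<le> K"
proof -
  obtain c where c: "0 \<le> c" "\<And>n x z U p. \<lbrakk>quasigeodesic_side X q x z U; p \<in> U; d x z \<le> 2^n + 2*C\<rbrakk>
      \<Longrightarrow> excess x p z \<le> c * (real n + 1)"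
    using excess_logarithmic by blast
  obtain a\<^sub>0 where a0: "0 \<le> a\<^sub>0" and
    a: "\<And>L. 0 \<le> L \<Longrightarrow> \<exists>n. L \<le> 2^n \<and> c * real n \<le> a\<^sub>0 + 1/8 * L"
    using logarithm_absorbed[OF c(1), of "1/8"] by auto
  define B where "B = 4*C + 5*\<delta> + 2"
  define A where "A = 4*\<delta> + 4*C + c + a\<^sub>0 + B/8"
  have A0: "0 \<le> A" using C_nonneg \<delta>_nonneg c(1) a0 by (simp add: A_def B_def)
  have "excess x p z \<le> 2*A + 1" if side: "quasigeodesic_side X q x z U" "p \<in> U" for x z U p
  proof -
    define D where "D = d x z"
    define P where "P \<Phi> \<longleftrightarrow> (\<forall>x z U p. quasigeodesic_side X q x z U \<longrightarrow> p \<in> U \<longrightarrow> d x z \<le> D \<longrightarrow> excess x p z \<le> \<Phi>)" for \<Phi>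
    obtain n where n: "D < 2^n" using real_arch_pow[of 2 D] by auto
    have "P (2*A + 1)"
    proof (rule halving_bound[OF _ _ _ A0])
      show "P (c * (real n + 1))"
        unfolding P_def
      proof (intro allI impI)
        fix x z U p assume "quasigeodesic_side X q x z U" "p \<in> U" "d x z \<le> D"
        moreover from this have "d x z \<le> 2^n + 2*C" using n C_nonneg by linarith
        ultimately show "excess x p z \<le> c * (real n + 1)" using c(2) by blast
      qed
      show "P s" if "P r" "r \<le> s" for r s using that unfolding P_def by (meson order_trans)
      fix \<Phi> assume \<Phi>: "0 \<le> \<Phi>" and "P \<Phi>"
      note bound = \<open>P \<Phi>\<close>[unfolded P_def]
      show "P (A + \<Phi>/2)"
        unfolding P_def
      proof (intro allI impI)
        fix x z U p assume U: "quasigeodesic_side X q x z U" "p \<in> U" "d x z \<le> D"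
        obtain w S p\<^sub>1 where S: "quasigeodesic_side X q x w S" "p\<^sub>1 \<in> S" "d x w \<le> D"
          and p1: "d p\<^sub>1 w \<le> 2*\<Phi> + 2*C + 2*\<delta> + 1" "excess x p z \<le> excess x p\<^sub>1 w + 2*\<delta> + 2*C"
          using excess_shorten[OF bound \<Phi> U] by blast
        have "d w x \<le> D" using S(3) by (simp add: mdist_commute)
        then obtain v T p\<^sub>2 where T: "quasigeodesic_side X q w v T" "p\<^sub>2 \<in> T" "d p\<^sub>1 p\<^sub>2 \<le> \<delta>"
          and p2: "d p\<^sub>2 v \<le> 2*\<Phi> + 2*C + 2*\<delta> + 1" "excess w p\<^sub>1 x \<le> excess w p\<^sub>2 v + 2*\<delta> + 2*C"
          using excess_shorten[OF bound \<Phi> quasigeodesic_side_reverse[OF S(1)] S(2)] \<open>d w x \<le> D\<close> by blast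
        have M: "w \<in> mspace X" "v \<in> mspace X" "p\<^sub>1 \<in> mspace X" "p\<^sub>2 \<in> mspace X"
          using quasigeodesic_sideD[OF T(1)] quasigeodesic_sideD[OF S(1)] S(2) T(2) by auto
        have short: "d w v \<le> 4*\<Phi> + B"
          using mdist_triangle[OF M(1,4,2)] mdist_triangle[OF M(1,3,4)] T(3) p1(1) p2(1) mdist_commute[of X w p\<^sub>1]
          unfolding B_def by linarith
        have "0 \<le> 4*\<Phi> + B" using \<Phi> C_nonneg \<delta>_nonneg by (simp add: B_def)
        then obtain k where k: "4*\<Phi> + B \<le> 2^k" "c * real k \<le> a\<^sub>0 + 1/8 * (4*\<Phi> + B)" using a by blast
        have "d w v \<le> 2^k + 2*C" using short k(1) C_nonneg by linarith
        then have "excess w p\<^sub>2 v \<le> c * real k + c" using c(2)[OF T(1,2)] by (simp add: algebra_simps)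
        then have "excess x p z \<le> c * real k + c + 4*\<delta> + 4*C"
          using p1(2) p2(2) path_excess_reverse[of X w p\<^sub>1 x] by simp
        also have "\<dots> \<le> A + \<Phi>/2" using k(2) unfolding A_def by argo
        finally show "excess x p z \<le> A + \<Phi>/2" .
      qed
    qed
    then show ?thesis using side unfolding P_def D_def by blast
  qed
  then show ?thesis using A0 by (intro exI[of _ "2*A + 1"]) auto
qed

text \<open>The parameter interval of \<open>U\<close> is covered by the points close to \<open>S\<close> and those close to \<open>T\<close>; a
  point where these two sets come close to each other is a centre of the triangle.\<close>

lemma triangle_centre:
  assumes U: "quasigeodesic_side X q x z U" and S: "quasigeodesic_side X q x y S"
    and T: "quasigeodesic_side X q y z T"
  obtains p s t where "p \<in> U" "s \<in> S" "t \<in> T" "d p s \<le> \<delta>" "d p t \<le> \<delta> + 2*q"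
proof -
  obtain a b c where ab: "a \<le> b" and c: "c a = x" "c b = z" and Uc: "U = c ` {a..b}" "1 \<le> q"
    and cM: "\<And>t. t \<in> {a..b} \<Longrightarrow> c t \<in> mspace X"
    and "\<And>s t. \<lbrakk>s \<in> {a..b}; t \<in> {a..b}\<rbrakk> \<Longrightarrow> \<bar>s - t\<bar> \<le> q * (d (c s) (c t) + q)"
    and upper: "\<And>s t. \<lbrakk>s \<in> {a..b}; t \<in> {a..b}\<rbrakk> \<Longrightarrow> d (c s) (c t) \<le> q * \<bar>s - t\<bar> + q"
    by (rule quasigeodesic_sideE[OF U]) blast
  note SD = quasigeodesic_sideD[OF S] and TD = quasigeodesic_sideD[OF T]
  obtain u v where uv: "u \<in> {a..b}" "v \<in> {a..b}" "\<bar>u - v\<bar> \<le> 1"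
    and s: "\<exists>p'\<in>S. d (c u) p' \<le> \<delta>" and t: "\<exists>p'\<in>T. d (c v) p' \<le> \<delta>"
  proof (rule interval_coarsely_connected[OF ab,
        of "\<lambda>t. \<exists>p'\<in>S. d (c t) p' \<le> \<delta>" "\<lambda>t. \<exists>p'\<in>T. d (c t) p' \<le> \<delta>"])
    show "(\<exists>p'\<in>S. d (c t) p' \<le> \<delta>) \<or> (\<exists>p'\<in>T. d (c t) p' \<le> \<delta>)" if "t \<in> {a..b}" for t
      using thin[OF U S T] Uc(1) that by blast
    show "\<exists>p'\<in>S. d (c a) p' \<le> \<delta>" using SD c \<delta>_nonneg by (intro bexI[of _ x]) auto
    show "\<exists>p'\<in>T. d (c b) p' \<le> \<delta>" using TD c \<delta>_nonneg by (intro bexI[of _ z]) auto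
  qed blast
  obtain s' t' where st: "s' \<in> S" "d (c u) s' \<le> \<delta>" "t' \<in> T" "d (c v) t' \<le> \<delta>" using s t by blast
  have "q * \<bar>u - v\<bar> \<le> q * 1" using uv(3) q by (intro mult_left_mono) auto
  then have "d (c u) (c v) \<le> 2*q" using upper[OF uv(1,2)] by simp
  moreover have "t' \<in> mspace X" using st TD by blast
  ultimately have "d (c u) t' \<le> \<delta> + 2*q"
    using mdist_triangle[OF cM[OF uv(1)] cM[OF uv(2)], of t'] st(4) by simp
  then show thesis using that[of "c u" s' t'] st uv(1) Uc(1) by blast
qed

text \<open>Since points on a quasigeodesic lie between its ends, the Gromov product of \<open>x\<close> and \<open>z\<close> at \<open>w\<close> is, up to a
  constant, the distance from \<open>w\<close> to a quasigeodesic from \<open>x\<close> to \<open>z\<close>; the point of the quasigeodesic realising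
  it is the centre of the triangle with vertices \<open>x\<close>, \<open>w\<close>, \<open>z\<close>. The four-point condition then says that
  triangles are thin.\<close>

lemma four_point_hyperbolic: "four_point_hyperbolic X"
proof -
  obtain K where K: "0 \<le> K" "\<And>x z U p. \<lbrakk>quasigeodesic_side X q x z U; p \<in> U\<rbrakk> \<Longrightarrow> excess x p z \<le> K"
    using excess_bounded by blast
  have product_le: "gp w x z \<le> d w p + K/2"
    if "quasigeodesic_side X q x z U" "p \<in> U" "w \<in> mspace X" for w x z U p
  proof -
    have M: "x \<in> mspace X" "z \<in> mspace X" "p \<in> mspace X" using quasigeodesic_sideD[OF that(1)] that(2) by auto
    show ?thesis
      using K(2)[OF that(1,2)] mdist_triangle[OF M(1,3) that(3)] mdist_triangle[OF M(2,3) that(3)]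
        mdist_commute[of X p w] mdist_commute[of X p z]
      unfolding Gromov_product_def path_excess_def by argo
  qed
  have le_product: "\<exists>p\<in>U. d w p \<le> gp w x z + (4*\<delta> + 8*q + 2*K)/2"
    if U: "quasigeodesic_side X q x z U" and w: "w \<in> mspace X" for w x z U
  proof -
    have M: "x \<in> mspace X" "z \<in> mspace X" using quasigeodesic_sideD[OF U] by auto
    obtain S T where S: "quasigeodesic_side X q x w S" and T: "quasigeodesic_side X q w z T"
      using joined w M by blast
    obtain p s t where p: "p \<in> U" and s: "s \<in> S" "d p s \<le> \<delta>" and t: "t \<in> T" "d p t \<le> \<delta> + 2*q"
      using triangle_centre[OF U S T] by metis
    have M': "p \<in> mspace X" "s \<in> mspace X" "t \<in> mspace X"
      using quasigeodesic_sideD[OF U] quasigeodesic_sideD[OF S] quasigeodesic_sideD[OF T] p s t by auto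
    have "d x p + d p w \<le> d x w + 2*\<delta> + K"
      using K(2)[OF S s(1)] mdist_triangle[OF M(1) M'(2,1)] mdist_triangle[OF M'(1,2) w] s(2) mdist_commute[of X s p]
      unfolding path_excess_def by argo
    moreover have "d w p + d p z \<le> d w z + 2*(\<delta> + 2*q) + K"
      using K(2)[OF T t(1)] mdist_triangle[OF w M'(3,1)] mdist_triangle[OF M'(1,3) M(2)] t(2) mdist_commute[of X t p]
      unfolding path_excess_def by argo
    moreover have "d x z \<le> d x p + d p z" using mdist_triangle[OF M(1) M'(1) M(2)] .
    ultimately have "d w p \<le> gp w x z + (4*\<delta> + 8*q + 2*K)/2"
      using mdist_commute[of X p w] mdist_commute[of X w z] q unfolding Gromov_product_def by argo
    then show ?thesis using p by blast
  qed
  define \<epsilon> where "\<epsilon> = (4*\<delta> + 8*q + 2*K)/2 + \<delta> + K/2"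
  have "min (gp w x y) (gp w y z) - \<epsilon> \<le> gp w x z"
    if M: "w \<in> mspace X" "x \<in> mspace X" "y \<in> mspace X" "z \<in> mspace X" for w x y z
  proof -
    obtain U S T where U: "quasigeodesic_side X q x z U" and S: "quasigeodesic_side X q x y S"
      and T: "quasigeodesic_side X q y z T"
      using joined M by meson
    obtain p where p: "p \<in> U" "d w p \<le> gp w x z + (4*\<delta> + 8*q + 2*K)/2" using le_product[OF U M(1)] by blast
    have pM: "p \<in> mspace X" using p quasigeodesic_sideD[OF U] by blast
    have *: "d w p' + K/2 - \<epsilon> \<le> gp w x z" if "p' \<in> mspace X" "d p p' \<le> \<delta>" for p'
      using mdist_triangle[OF M(1) pM that(1)] that(2) p(2) unfolding \<epsilon>_def by linarith
    consider p' where "p' \<in> S" "d p p' \<le> \<delta>" | p' where "p' \<in> T" "d p p' \<le> \<delta>"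
      using thin[OF U S T p(1)] by blast
    then show ?thesis
    proof cases
      case (1 p')
      then show ?thesis using *[of p'] product_le[OF S 1(1) M(1)] quasigeodesic_sideD(3)[OF S] by auto
    next
      case (2 p')
      then show ?thesis using *[of p'] product_le[OF T 2(1) M(1)] quasigeodesic_sideD(3)[OF T] by auto
    qed
  qed
  then show ?thesis unfolding four_point_hyperbolic_def by blast
qed

end

section \<open>Rough isometries and the injective hull\<close>

lemma four_point_hyperbolic_pullback:
  assumes f: "\<And>x. x \<in> mspace Y \<Longrightarrow> f x \<in> mspace X"
    and close: "\<And>x y. \<lbrakk>x \<in> mspace Y; y \<in> mspace Y\<rbrakk> \<Longrightarrow> \<bar>mdist X (f x) (f y) - mdist Y x y\<bar> \<le> k"
    and hyp: "four_point_hyperbolic X"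
  shows "four_point_hyperbolic Y"
proof -
  obtain \<delta> where \<delta>: "\<And>w x y z. \<lbrakk>w \<in> mspace X; x \<in> mspace X; y \<in> mspace X; z \<in> mspace X\<rbrakk> \<Longrightarrow>
      min (Gromov_product X w x y) (Gromov_product X w y z) - \<delta> \<le> Gromov_product X w x z"
    using hyp unfolding four_point_hyperbolic_def by blast
  have gp: "\<bar>Gromov_product X (f w) (f x) (f y) - Gromov_product Y w x y\<bar> \<le> 3/2*k"
    if "w \<in> mspace Y" "x \<in> mspace Y" "y \<in> mspace Y" for w x y
    using close[OF that(2,1)] close[OF that(3,1)] close[OF that(2,3)]
    unfolding Gromov_product_def abs_le_iff by argo
  have "min (Gromov_product Y w x y) (Gromov_product Y w y z) - (\<delta> + 3*k) \<le> Gromov_product Y w x z"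
    if M: "w \<in> mspace Y" "x \<in> mspace Y" "y \<in> mspace Y" "z \<in> mspace Y" for w x y z
    using \<delta>[OF f[OF M(1)] f[OF M(2)] f[OF M(3)] f[OF M(4)]]
      gp[OF M(1,2,3)] gp[OF M(1,3,4)] gp[OF M(1,2,4)]
    unfolding min_def abs_le_iff by argo
  then show ?thesis unfolding four_point_hyperbolic_def by blast
qed

lemma weakly_roughly_geodesic_pullback:
  assumes Y: "geodesic_space Y" and f: "rough_isometry X Y f"
  shows "weakly_roughly_geodesic X"
proof -
  obtain k where k: "quasi_isometry X Y 1 k f" using f unfolding rough_isometry_def by blast
  have fY: "f x \<in> mspace Y" if "x \<in> mspace X" for x
    using k that by (auto simp: quasi_isometry_def quasi_isometric_embedding_def)
  have close: "mdist X x y - k \<le> mdist Y (f x) (f y)" "mdist Y (f x) (f y) \<le> mdist X x y + k"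
    if "x \<in> mspace X" "y \<in> mspace X" for x y
    using k that by (auto simp: quasi_isometry_def quasi_isometric_embedding_def)
  have dense: "\<exists>x\<in>mspace X. mdist Y (f x) u \<le> k" if "u \<in> mspace Y" for u
    using k that by (auto simp: quasi_isometry_def)
  have "\<exists>z\<in>mspace X. mdist X x z \<le> r + 3*k \<and> mdist X z y \<le> (mdist X x y - r) + 3*k"
    if xy: "x \<in> mspace X" "y \<in> mspace X" and r: "r \<in> {0..mdist X x y}" for x y r
  proof -
    let ?D = "mdist Y (f x) (f y)"
    have k0: "0 \<le> k" using k by (simp add: quasi_isometry_def quasi_isometric_embedding_def)
    obtain c where c: "isometric_embedding (submetric euclidean_metric {0..?D}) Y c" "c 0 = f x" "c ?D = f y"
      using Y fY xy unfolding geodesic_space_def by blast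
    define s where "s = min r ?D"
    have s: "0 \<le> s" "s \<le> ?D" "s \<le> r" "?D - s \<le> mdist X x y - r + k"
      using r close(2)[OF xy] k0 by (auto simp: s_def)
    have cd: "mdist Y (c u) (c v) = \<bar>u - v\<bar>" if "u \<in> {0..?D}" "v \<in> {0..?D}" for u v
      using isometric_embedding_mdist[OF c(1), of u v] that by (simp add: dist_real_def)
    have cs: "c s \<in> mspace Y" using isometric_embedding_in[OF c(1), of s] s by simp
    have ds: "mdist Y (f x) (c s) = s" "mdist Y (c s) (f y) = ?D - s"
      using cd[of 0 s] cd[of s ?D] s c by auto
    obtain z where z: "z \<in> mspace X" "mdist Y (f z) (c s) \<le> k" using dense[OF cs] by blast
    have "mdist X x z \<le> s + 2*k"
      using close(1)[OF xy(1) z(1)] mdist_triangle[OF fY[OF xy(1)] cs fY[OF z(1)]] ds z(2)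
        mdist_commute[of Y "f z" "c s"] by linarith
    moreover have "mdist X z y \<le> ?D - s + 2*k"
      using close(1)[OF z(1) xy(2)] mdist_triangle[OF fY[OF z(1)] cs fY[OF xy(2)]] ds z(2) by linarith
    ultimately show ?thesis using z(1) s k0 by (intro bexI[of _ z]) auto
  qed
  then show ?thesis unfolding weakly_roughly_geodesic_def by blast
qed

text \<open>The empty space is itself injective, so the hull must embed into it.\<close>

lemma injective_hull_empty:
  assumes E: "injective_hull X E e" and "mspace X = {}"
  shows "mspace E = {}"
proof -
  have "isometric_embedding X (submetric E {}) e" "injective_space (submetric E {})"
    using assms(2) by (auto simp: isometric_embedding_def intro: injective_space_empty)
  then obtain h where "isometric_embedding E (submetric E {}) h"
    using injective_hull_factor[OF E] by blast
  then show ?thesis by (auto simp: isometric_embedding_def)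
qed

lemma hull_isometry_extends:
  assumes "injective_hull X E e" "\<phi> \<in> Isom X" "x \<in> mspace X"
  shows "hull_isometry X E e \<phi> (e x) = e (\<phi> x)"
  using theI'[OF hull_isometry_ex1[OF assms(1,2)]] assms(3) unfolding hull_isometry_def by blast

context hyperbolic_weakly_roughly_geodesic
begin

text \<open>An extremal function \<open>f\<close> nearly attains \<open>f x + f y = d x y\<close>, so \<open>x\<close> and \<open>y\<close> have a point \<open>z\<close> between them at
  distances about \<open>f x\<close> and \<open>f y\<close>. For any other point \<open>w\<close>, the four-point condition bounds the sum of
  \<open>d w z\<close> and \<open>d x y\<close> by about \<open>f w + f x + f y\<close>, whence \<open>d w z\<close> is at most about \<open>f w\<close>. By minimality of extremal
  functions this one-sided comparison suffices.\<close>

lemma extremal_near_Kuratowski: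
  assumes f: "f \<in> extremal_functions X" and ne: "mspace X \<noteq> {}"
  shows "\<exists>z\<in>mspace X. extremal_dist X (Kuratowski X z) f \<le> C + 2*\<delta> + 1"
proof -
  obtain x where x: "x \<in> mspace X" using ne by blast
  obtain y where y: "y \<in> mspace X" "f x + f y < d x y + 1" using extremal_tight[OF f x, of 1] by auto
  define r where "r = min (f x) (d x y)"
  have r: "0 \<le> r" "r \<le> d x y" "r \<le> f x" "d x y - r \<le> f y"
    using extremal_nonneg[OF f x] extremal_nonneg[OF f y(1)] extremal_dom[OF f x y(1)] by (auto simp: r_def)
  obtain z where z: "z \<in> mspace X" "d x z \<le> r + C" "d z y \<le> d x y - r + C"
    using roughly_between[OF x y(1) r(1,2)] by blast
  have "extremal_dist X (Kuratowski X z) f \<le> C + 2*\<delta> + 1"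
  proof (rule extremal_dist_le[OF ne Kuratowski_extremal[OF ne z(1)] f])
    fix w assume w: "w \<in> mspace X"
    have "d w z + d x y \<le> f w + f x + f y + C + 2*\<delta>"
      using four_point_sum[OF w x y(1) z(1)] extremal_dom[OF f x w] extremal_dom[OF f w y(1)] z(2,3) r(3,4)
      by argo
    then have "d z w \<le> f w + (C + 2*\<delta> + 1)" using y(2) mdist_commute[of X z w] by linarith
    then show "Kuratowski X z w \<le> f w + (C + 2*\<delta> + 1)" using w by (simp add: Kuratowski_def)
  qed
  then show ?thesis using z(1) by blast
qed

text \<open>The hull embeds into the tight span, where its points become extremal functions.\<close>

lemma injective_hull_near:
  assumes E: "injective_hull X E e" and p: "p \<in> mspace E"
  shows "\<exists>z\<in>mspace X. mdist E (e z) p \<le> C + 2*\<delta> + 1"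
proof -
  have ne: "mspace X \<noteq> {}" using injective_hull_empty[OF E] p by blast
  obtain h where h: "isometric_embedding E (tight_span X) h" "\<forall>x\<in>mspace X. h (e x) = Kuratowski X x"
    using injective_hullD(3)[OF E injective_tight_span[OF ne] Kuratowski_embedding[OF ne]] by blast
  have "h p \<in> extremal_functions X" using isometric_embedding_in[OF h(1) p] ne by simp
  then obtain z where z: "z \<in> mspace X" "extremal_dist X (Kuratowski X z) (h p) \<le> C + 2*\<delta> + 1"
    using extremal_near_Kuratowski[OF _ ne] by blast
  have "e z \<in> mspace E" using isometric_embedding_in[OF injective_hullD(2)[OF E] z(1)] .
  then show ?thesis
    using isometric_embedding_mdist[OF h(1) _ p, of "e z"] h(2) z ne by auto
qed

lemma rough_isometry_hull:
  assumes E: "injective_hull X E e"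
  shows "rough_isometry X E e"
proof -
  note e = injective_hullD(2)[OF E]
  have "quasi_isometry X E 1 (C + 2*\<delta> + 1) e"
    unfolding quasi_isometry_def quasi_isometric_embedding_def
    using e injective_hull_near[OF E] C_nonneg \<delta>_nonneg by (auto simp: isometric_embedding_def)
  then show ?thesis unfolding rough_isometry_def by blast
qed

lemma injective_hull_hyperbolic:
  assumes E: "injective_hull X E e" and hyp: "four_point_hyperbolic X"
  shows "four_point_hyperbolic E"
proof -
  note e = injective_hullD(2)[OF E]
  obtain g where g: "\<And>p. p \<in> mspace E \<Longrightarrow> g p \<in> mspace X"
      "\<And>p. p \<in> mspace E \<Longrightarrow> mdist E (e (g p)) p \<le> C + 2*\<delta> + 1"
    using injective_hull_near[OF E] by metis
  have "\<bar>d (g p) (g p') - mdist E p p'\<bar> \<le> 2*C + 4*\<delta> + 2" if p: "p \<in> mspace E" "p' \<in> mspace E" for p p'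
  proof -
    have M: "e (g p) \<in> mspace E" "e (g p') \<in> mspace E"
      using isometric_embedding_in[OF e] g(1) p by auto
    have "d (g p) (g p') = mdist E (e (g p)) (e (g p'))"
      using isometric_embedding_mdist[OF e] g(1) p by simp
    then show ?thesis
      using mdist_triangle[OF M(1) p(1) M(2)] mdist_triangle[OF p M(2)] mdist_triangle[OF p(1) M(1) p(2)]
        mdist_triangle[OF M p(2)] g(2)[OF p(1)] g(2)[OF p(2)]
        mdist_commute[of E p "e (g p)"] mdist_commute[of E p' "e (g p')"] unfolding abs_le_iff by linarith
  qed
  then show ?thesis
    by (intro four_point_hyperbolic_pullback[of E g X, OF _ _ hyp]) (use g(1) in auto)
qed

end

section \<open>Equivalence of the three conditions\<close>

lemma hyperbolic_weakly_roughly_geodesic_exists: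
  assumes "four_point_hyperbolic X" "weakly_roughly_geodesic X"
  obtains \<delta> C where "hyperbolic_weakly_roughly_geodesic X \<delta> C"
proof -
  obtain \<delta> where \<delta>: "\<And>w x y z. \<lbrakk>w \<in> mspace X; x \<in> mspace X; y \<in> mspace X; z \<in> mspace X\<rbrakk> \<Longrightarrow>
      min (Gromov_product X w x y) (Gromov_product X w y z) - \<delta> \<le> Gromov_product X w x z"
    using assms(1) unfolding four_point_hyperbolic_def by blast
  obtain C where C: "\<And>x y r. \<lbrakk>x \<in> mspace X; y \<in> mspace X; r \<in> {0..mdist X x y}\<rbrakk> \<Longrightarrow>
      \<exists>z\<in>mspace X. mdist X x z \<le> r + C \<and> mdist X z y \<le> (mdist X x y - r) + C"
    using assms(2) unfolding weakly_roughly_geodesic_def by blast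
  have "hyperbolic_weakly_roughly_geodesic X (max \<delta> 0) (max C 0)"
  proof
    show "min (Gromov_product X w x y) (Gromov_product X w y z) - max \<delta> 0 \<le> Gromov_product X w x z"
      if "w \<in> mspace X" "x \<in> mspace X" "y \<in> mspace X" "z \<in> mspace X" for w x y z
      using \<delta>[OF that] by linarith
    fix x y r assume "x \<in> mspace X" "y \<in> mspace X" "0 \<le> r" "r \<le> mdist X x y"
    then obtain z where "z \<in> mspace X" "mdist X x z \<le> r + C" "mdist X z y \<le> (mdist X x y - r) + C"
      using C[of x y r] by auto
    then show "\<exists>z\<in>mspace X. mdist X x z \<le> r + max C 0 \<and> mdist X z y \<le> (mdist X x y - r) + max C 0"
      by (intro bexI[of _ z]) auto
  qed auto
  then show thesis by (rule that)
qed

lemma thin_weakly_roughly_geodesic_exists: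
  assumes "quasihyperbolic X" "weakly_roughly_geodesic X"
  obtains q \<delta> C where "thin_weakly_roughly_geodesic X q \<delta> C"
proof -
  obtain q where q: "1 \<le> q" "quasigeodesic_space X q"
    using assms(1) unfolding quasihyperbolic_def by blast
  obtain \<delta> where \<delta>: "\<And>x y z S T U. \<lbrakk>x \<in> mspace X; y \<in> mspace X; z \<in> mspace X;
      quasigeodesic_side X q x y S; quasigeodesic_side X q y z T; quasigeodesic_side X q z x U\<rbrakk>
      \<Longrightarrow> thin_triangle X \<delta> S T U"
    using assms(1) q(1) unfolding quasihyperbolic_def by meson
  obtain C where C: "\<And>x y r. \<lbrakk>x \<in> mspace X; y \<in> mspace X; r \<in> {0..mdist X x y}\<rbrakk> \<Longrightarrow>
      \<exists>z\<in>mspace X. mdist X x z \<le> r + C \<and> mdist X z y \<le> (mdist X x y - r) + C"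
    using assms(2) unfolding weakly_roughly_geodesic_def by blast
  have "thin_weakly_roughly_geodesic X q (max \<delta> 0) (max C 0)"
  proof
    show "\<exists>S. quasigeodesic_side X q x y S" if "x \<in> mspace X" "y \<in> mspace X" for x y
      using q(2) that unfolding quasigeodesic_space_def by blast
    show "(\<exists>p'\<in>S. mdist X p p' \<le> max \<delta> 0) \<or> (\<exists>p'\<in>T. mdist X p p' \<le> max \<delta> 0)"
      if U: "quasigeodesic_side X q x z U" and S: "quasigeodesic_side X q x y S"
        and T: "quasigeodesic_side X q y z T" and p: "p \<in> U" for x y z S T U p
    proof -
      have "thin_triangle X \<delta> S T U"
        using quasigeodesic_sideD[OF S] quasigeodesic_sideD[OF T]
        by (intro \<delta>[OF _ _ _ S T quasigeodesic_side_reverse[OF U]]) auto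
      then obtain p' where "p' \<in> S \<union> T" "mdist X p' p \<le> \<delta>"
        using p unfolding thin_triangle_def nbhd_def by fastforce
      then have "p' \<in> S \<union> T" "mdist X p p' \<le> max \<delta> 0" by (auto simp: mdist_commute)
      then show ?thesis by blast
    qed
    fix x y r assume "x \<in> mspace X" "y \<in> mspace X" "0 \<le> r" "r \<le> mdist X x y"
    then obtain z where "z \<in> mspace X" "mdist X x z \<le> r + C" "mdist X z y \<le> (mdist X x y - r) + C"
      using C[of x y r] by auto
    then show "\<exists>z\<in>mspace X. mdist X x z \<le> r + max C 0 \<and> mdist X z y \<le> (mdist X x y - r) + max C 0"
      by (intro bexI[of _ z]) auto
  qed (use q(1) in auto)
  then show thesis by (rule that)
qed

theorem proposition14:
  fixes X :: "'a metric" and E :: "'e metric" and e :: "'a \<Rightarrow> 'e"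
  assumes "injective_hull X E e"
  shows "(quasihyperbolic X \<and> weakly_roughly_geodesic X
            \<longleftrightarrow> four_point_hyperbolic X \<and> weakly_roughly_geodesic X) \<and>
         (four_point_hyperbolic X \<and> weakly_roughly_geodesic X
            \<longleftrightarrow> equivariantly_roughly_isometric_to_hull X E e \<and> four_point_hyperbolic E)"
proof -
  have "four_point_hyperbolic X" if "quasihyperbolic X" "weakly_roughly_geodesic X"
    using thin_weakly_roughly_geodesic_exists[OF that] thin_weakly_roughly_geodesic.four_point_hyperbolic by blast
  moreover have "quasihyperbolic X" if "four_point_hyperbolic X" "weakly_roughly_geodesic X"
    using hyperbolic_weakly_roughly_geodesic_exists[OF that] hyperbolic_weakly_roughly_geodesic.quasihyperbolic by blast
  moreover have "equivariantly_roughly_isometric_to_hull X E e \<and> four_point_hyperbolic E"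
    if hyp: "four_point_hyperbolic X" "weakly_roughly_geodesic X"
  proof -
    obtain \<delta> C where "hyperbolic_weakly_roughly_geodesic X \<delta> C"
      using hyperbolic_weakly_roughly_geodesic_exists[OF hyp] .
    then interpret hyperbolic_weakly_roughly_geodesic X \<delta> C .
    show ?thesis
      unfolding equivariantly_roughly_isometric_to_hull_def
      using rough_isometry_hull[OF assms] hull_isometry_extends[OF assms] injective_hull_hyperbolic[OF assms hyp(1)]
      by (intro conjI exI[of _ e]) auto
  qed
  moreover have "four_point_hyperbolic X \<and> weakly_roughly_geodesic X"
    if E: "equivariantly_roughly_isometric_to_hull X E e" "four_point_hyperbolic E"
  proof
    obtain f where f: "rough_isometry X E f"
      using E(1) unfolding equivariantly_roughly_isometric_to_hull_def by blast
    then obtain k where "quasi_isometric_embedding X E 1 k f"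
      unfolding rough_isometry_def quasi_isometry_def by blast
    then have k: "f \<in> mspace X \<rightarrow> mspace E" "\<forall>x\<in>mspace X. \<forall>y\<in>mspace X.
        mdist X x y - k \<le> mdist E (f x) (f y) \<and> mdist E (f x) (f y) \<le> mdist X x y + k"
      by (simp_all add: quasi_isometric_embedding_def)
    have "\<bar>mdist E (f x) (f y) - mdist X x y\<bar> \<le> k" if "x \<in> mspace X" "y \<in> mspace X" for x y
      using k(2)[rule_format, OF that] by linarith
    with k(1) show "four_point_hyperbolic X"
      by (intro four_point_hyperbolic_pullback[of X f E k, OF _ _ E(2)]) auto
    have "geodesic_space E"
      using injective_hullD(1)[OF assms] unfolding injective_space_def by (rule conjunct1)
    then show "weakly_roughly_geodesic X" using weakly_roughly_geodesic_pullback f by blast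
  qed
  ultimately show ?thesis by blast
qed

end
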